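(* Let $S$ be a surface with or without boundary with a finite polygonal cellular decomposition $\Sigma=(V,E,F)$, where $V,E,F$ are the sets of vertices, edges and faces. Let $L=(L_v)_{v\in V}$ and $Y=(Y_f)_{f\in F}$ be real vectors. There exists a surface $\hat S$ with a generalized circle packing metric having total geodesic curvature $L_v$ on the generalized circle of each $v\in V$ and discrete Gaussian curvature $Y_f$ at the center of the dual circle of each $f\in F$ if and only if $Y_f\in((2-N(f))\pi,2\pi)$ for each $f\in F$ and $L\in\mathcal L$, where $$\mathcal L=\Big\{(L_v)_{v\in V}\in\mathbb R_{>0}^{|V|}\ \Big|\ \sum_{w\in W}L_w<\sum_{f\in F_W}\pi\min\Big\{N(f,W),\,N(f)-2+\frac{Y_f}{\pi}\Big\}\ \text{ for all nonempty } W\subset V\Big\}.$$ Moreover, the generalized circle packing metric is unique if it exists.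
   Context: For a face $f$, $V_f$ is its set of vertices and $N(f)=|V_f|$. For $W\subset V$, $F_W$ is the set of faces having at least one vertex in $W$, and $N(f,W)=|W\cap V_f|$. Generalized circles in $\mathbb H^2$: circles (radius $r$, geodesic curvature $\coth r>1$), horocycles (geodesic curvature $1$), hypercycles (curves at constant distance $r$ from a geodesic, geodesic curvature $\tanh r\in(0,1)$). For $k_0>1$, $x>0$ put $\theta(k_0,x)=2\arctan(\sqrt{k_0^2-1}/x)\in(0,\pi)$; this is the angle, at the center of a circle $C_0$ of geodesic curvature $k_0$, subtended by the arc of $C_0$ cut off by a generalized circle of geodesic curvature $x$ perpendicular to $C_0$. Generalized circle packing metric: let $k=(k_v)_{v\in V}\in\mathbb R_{>0}^{|V|}$ (geodesic curvatures) and let $Y_f$ be the discrete Gaussian curvature prescribed on each face, i.e. the cone angle is $\alpha_f=2\pi-Y_f$; here $\alpha_f\in(0,N(f)\pi)$. For each $f$ there is a unique $k_f>1$ with $\sum_{v\in V_f}\theta(k_f,k_v)=\alpha_f$. Gluing, cyclically around the common center of the circle of curvature $k_f$, the quadrilaterals determined by the perpendicular pairs of curvatures $(k_f,k_v)$, $v\in V_f$ (vertices: the centers of the two circles and their intersection points; the "center" of a horocycle is its ideal point, that of a hypercycle is its geodesic axis), gives a hyperbolic conical polygon $\hat f$ containing a generalized circle packing of $f$: generalized circles $C_v$ of geodesic curvature $k_v$, consecutive ones tangent, all perpendicular to the dual circle $C_f$ of geodesic curvature $k_f$, whose center is a cone point of angle $\alpha_f$. Gluing all polygons $\hat f$ along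 their edges gives a surface $\hat S$ with a hyperbolic conical metric, called the generalized circle packing metric. Given $Y$, these metrics are parametrized by $k\in\mathbb R_{>0}^{|V|}$, and uniqueness means uniqueness of $k$. Total geodesic curvature: $C_{v,f}$ is the sub-arc of $C_v$ contained in the dual circle $C_f$, $l_{v,f}$ its length, $L_{v,f}=k_vl_{v,f}$, and the total geodesic curvature at $v$ is $L_v=\sum_{f\ni v}L_{v,f}$. Explicitly, $$L_{v,f}=\begin{cases}\frac{2k_v}{\sqrt{k_v^2-1}}\arctan\frac{\sqrt{k_v^2-1}}{k_f},&k_v>1,\\ \frac{2}{k_f},&k_v=1,\\ \frac{2k_v}{\sqrt{1-k_v^2}}\operatorname{arctanh}\frac{\sqrt{1-k_v^2}}{k_f},&0<k_v<1.\end{cases}$$ *)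

theory Defs
  imports "HOL-Analysis.Analysis"
begin

section \<open>Surfaces and polygonal cellular decompositions\<close>

definition surface :: "'a topology \<Rightarrow> bool" where
  "surface S \<longleftrightarrow>
     Hausdorff_space S \<and> second_countable S \<and>
     (\<forall>x\<in>topspace S. \<exists>U H. openin S U \<and> x \<in> U \<and>
        openin (top_of_set {z::complex. 0 \<le> Im z}) H \<and>
        subtopology S U homeomorphic_space top_of_set H)"

text \<open>An edge is recorded as an open arc; its end points are vertices and may coincide.\<close>

definition edge_cell :: "'a topology \<Rightarrow> 'a set \<Rightarrow> 'a set \<Rightarrow> bool" where
  "edge_cell S V e \<longleftrightarrow>
     (\<exists>g. pathin S g \<and> g 0 \<in> V \<and> g 1 \<in> V \<and>
          homeomorphic_map (top_of_set {0<..<1}) (subtopology S e) g)"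

text \<open>A face is recorded as an open 2-cell.  Its characteristic map is defined on the closed unit
  disc, regarded as an \<open>n\<close>-gon with corners at the \<open>n\<close>-th roots of unity.\<close>

definition polygon_side :: "nat \<Rightarrow> nat \<Rightarrow> complex set" where
  "polygon_side n j = (\<lambda>t. cis (2 * pi * t / real n)) ` {real j<..<real j + 1}"

definition face_cell :: "'a topology \<Rightarrow> 'a set \<Rightarrow> 'a set set \<Rightarrow> 'a set \<Rightarrow> bool" where
  "face_cell S V E f \<longleftrightarrow>
     (\<exists>n \<phi>. 1 \<le> n \<and>
        continuous_map (top_of_set (cball (0::complex) 1)) S \<phi> \<and>
        homeomorphic_map (top_of_set (ball 0 1)) (subtopology S f) \<phi> \<and>
        (\<forall>j<n. \<phi> (cis (2 * pi * real j / real n)) \<in> V \<and>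
           (\<exists>e\<in>E. homeomorphic_map (top_of_set (polygon_side n j)) (subtopology S e) \<phi>)))"

definition polygonal_decomposition ::
    "'a topology \<Rightarrow> 'a set \<Rightarrow> 'a set set \<Rightarrow> 'a set set \<Rightarrow> bool" where
  "polygonal_decomposition S V E F \<longleftrightarrow>
     finite V \<and> finite E \<and> finite F \<and>
     topspace S = V \<union> \<Union>E \<union> \<Union>F \<and>
     pairwise disjnt ((\<lambda>v. {v}) ` V \<union> E \<union> F) \<and>
     (\<forall>e\<in>E. edge_cell S V e) \<and>
     (\<forall>f\<in>F. face_cell S V E f) \<and>
     topspace S = (\<Union>f\<in>F. S closure_of f)"

text \<open>Since \<open>S\<close> is Hausdorff, the closure of a face is the image of its closed polygon.\<close>

definition face_vertices :: "'a topology \<Rightarrow> 'a set \<Rightarrow> 'a set \<Rightarrow> 'a set" where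
  "face_vertices S V f = V \<inter> S closure_of f"

definition faces_meeting :: "'a topology \<Rightarrow> 'a set \<Rightarrow> 'a set set \<Rightarrow> 'a set \<Rightarrow> 'a set set" where
  "faces_meeting S V F W = {f\<in>F. \<exists>w\<in>W. w \<in> face_vertices S V f}"


section \<open>Perpendicular generalized circles in the Poincare disc\<close>

text \<open>The hyperbolic plane is the unit disc with the metric \<open>2 |dz| / (1 - |z|\<^sup>2)\<close> of curvature -1.\<close>

definition hyp_length :: "(real \<Rightarrow> complex) \<Rightarrow> real \<Rightarrow> real \<Rightarrow> real" where
  "hyp_length \<gamma> a b =
     integral {a..b} (\<lambda>t. 2 * cmod (vector_derivative \<gamma> (at t)) / (1 - (cmod (\<gamma> t))\<^sup>2))"

text \<open>Signed with respect to the left normal.  This is the usual formula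
  \<open>(\<kappa> - \<partial>\<^sub>n log \<lambda>) / \<lambda>\<close> for the geodesic curvature in the conformal metric
  \<open>\<lambda> |dz|\<close> with \<open>\<lambda> = 2 / (1 - |z|\<^sup>2)\<close>, where \<open>\<kappa>\<close> is the Euclidean curvature.\<close>

definition geodesic_curvature :: "(real \<Rightarrow> complex) \<Rightarrow> real \<Rightarrow> real" where
  "geodesic_curvature \<gamma> t =
     (let z = \<gamma> t;
          z' = vector_derivative \<gamma> (at t);
          z'' = vector_derivative (\<lambda>u. vector_derivative \<gamma> (at u)) (at t)
      in (1 - (cmod z)\<^sup>2) / 2 * (Im (cnj z' * z'') / cmod z' ^ 3) + Im (cnj z * z') / cmod z')"

text \<open>The circle \<open>C\<^sub>0\<close> of geodesic curvature \<open>k0 > 1\<close> centred at the origin has Euclidean radius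
  \<open>dual_radius k0\<close>.  The generalized circle of geodesic curvature \<open>x > 0\<close> perpendicular to it, with
  Euclidean centre on the positive real axis, has Euclidean centre \<open>perp_centre k0 x\<close> and Euclidean
  radius \<open>perp_radius k0 x\<close>; it is a circle, a horocycle or a hypercycle according to
  \<open>x > 1\<close>, \<open>x = 1\<close> or \<open>x < 1\<close>.  See the lemmas below.\<close>

definition dual_radius :: "real \<Rightarrow> real" where
  "dual_radius k0 = k0 - sqrt (k0\<^sup>2 - 1)"

definition perp_radius :: "real \<Rightarrow> real \<Rightarrow> real" where
  "perp_radius k0 x = (1 - (dual_radius k0)\<^sup>2) / (2 * x)"

definition perp_centre :: "real \<Rightarrow> real \<Rightarrow> real" where
  "perp_centre k0 x = sqrt ((dual_radius k0)\<^sup>2 + (perp_radius k0 x)\<^sup>2)"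

definition perp_circle :: "real \<Rightarrow> real \<Rightarrow> real \<Rightarrow> complex" where
  "perp_circle k0 x t = of_real (perp_centre k0 x) - of_real (perp_radius k0 x) * cis t"

text \<open>The sub-arc of \<open>perp_circle k0 x\<close> inside \<open>C\<^sub>0\<close> is the parameter range
  \<open>{- half_arc k0 x..half_arc k0 x}\<close>.\<close>

definition half_arc :: "real \<Rightarrow> real \<Rightarrow> real" where
  "half_arc k0 x = arctan (dual_radius k0 / perp_radius k0 x)"

definition arc_length :: "real \<Rightarrow> real \<Rightarrow> real" where
  "arc_length k0 x = hyp_length (perp_circle k0 x) (- half_arc k0 x) (half_arc k0 x)"

definition central_angle :: "real \<Rightarrow> real \<Rightarrow> real" where
  "central_angle k0 x = 2 * arctan (sqrt (k0\<^sup>2 - 1) / x)"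


subsection \<open>Consistency of the definitions\<close>

lemma dual_radius_bounds:
  assumes "1 < k0"
  shows "0 < dual_radius k0" "dual_radius k0 < 1"
    "k0 = (1 + (dual_radius k0)\<^sup>2) / (2 * dual_radius k0)"
    "sqrt (k0\<^sup>2 - 1) = (1 - (dual_radius k0)\<^sup>2) / (2 * dual_radius k0)"
proof -
  define q where "q = sqrt (k0\<^sup>2 - 1)"
  have k1: "1 < k0\<^sup>2" using assms by (simp add: one_less_power)
  have q2: "q\<^sup>2 = k0\<^sup>2 - 1" and q0: "0 < q" using k1 by (auto simp: q_def)
  have "q\<^sup>2 < k0\<^sup>2" unfolding q2 by simp
  then have "q < k0" using assms by (meson less_imp_le less_trans power2_less_imp_less zero_less_one)
  then show r0: "0 < dual_radius k0" by (simp add: dual_radius_def q_def)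
  have "(k0 - 1)\<^sup>2 < q\<^sup>2" unfolding q2 using assms by (simp add: power2_diff)
  then have "k0 - 1 < q" using q0 by (meson less_imp_le power2_less_imp_less)
  then show "dual_radius k0 < 1" by (simp add: dual_radius_def q_def)
  have r: "dual_radius k0 = k0 - q" by (simp add: dual_radius_def q_def)
  have e: "2 * (dual_radius k0 * k0) = 1 + (dual_radius k0)\<^sup>2"
    "2 * (dual_radius k0 * q) = 1 - (dual_radius k0)\<^sup>2"
    using q2 unfolding r by algebra+
  show "k0 = (1 + (dual_radius k0)\<^sup>2) / (2 * dual_radius k0)"
    unfolding e(1)[symmetric] using r0 by simp
  show "sqrt (k0\<^sup>2 - 1) = (1 - (dual_radius k0)\<^sup>2) / (2 * dual_radius k0)"
    unfolding e(2)[symmetric] q_def[symmetric] using r0 by simp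
qed

lemma perp_radius_pos:
  assumes "1 < k0" "0 < x"
  shows "0 < perp_radius k0 x" "1 - (dual_radius k0)\<^sup>2 = 2 * perp_radius k0 x * x"
proof -
  have "(dual_radius k0)\<^sup>2 < 1"
    using dual_radius_bounds[OF assms(1)] by (simp add: power_less_one_iff)
  then show "0 < perp_radius k0 x" using assms by (simp add: perp_radius_def)
  show "1 - (dual_radius k0)\<^sup>2 = 2 * perp_radius k0 x * x"
    using assms by (simp add: perp_radius_def)
qed

lemma has_vector_derivative_cis_scaled:
  "((\<lambda>t. a + b * cis t) has_vector_derivative (b * (\<i> * cis t))) (at t)"
proof -
  have "((\<lambda>z. a + b * exp (\<i> * z)) has_field_derivative (b * (\<i> * exp (\<i> * of_real t)))) (at (of_real t))"
    by (auto intro!: derivative_eq_intros)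
  then show ?thesis
    unfolding cis_conv_exp by (rule has_vector_derivative_real_field)
qed

lemma dual_circle_geodesic_curvature:
  assumes "1 < k0"
  shows "geodesic_curvature (\<lambda>t. of_real (dual_radius k0) * cis t) t = k0"
proof -
  define r where "r = dual_radius k0"
  have r: "0 < r" "k0 = (1 + r\<^sup>2) / (2 * r)" using dual_radius_bounds[OF assms] by (auto simp: r_def)
  have d1: "vector_derivative (\<lambda>t. of_real r * cis t) (at u) = of_real r * (\<i> * cis u)" for u
    using has_vector_derivative_cis_scaled[of 0 "of_real r" u] by (simp add: vector_derivative_at)
  have d2: "vector_derivative (\<lambda>u. of_real r * (\<i> * cis u)) (at t) = - (of_real r * cis t)"
    using has_vector_derivative_cis_scaled[of 0 "of_real r * \<i>" t]
    by (simp add: vector_derivative_at mult.assoc)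
  have sc: "sin t * sin t + cos t * cos t = 1"
    using sin_cos_squared_add[of t] by (simp add: power2_eq_square)
  have i1: "Im (cnj (of_real r * (\<i> * cis t)) * - (of_real r * cis t)) = r\<^sup>2"
    using sc by (simp add: power2_eq_square algebra_simps flip: distrib_left)
  have i2: "Im (cnj (of_real r * cis t) * (of_real r * (\<i> * cis t))) = r\<^sup>2"
    using sc by (simp add: power2_eq_square algebra_simps flip: distrib_left)
  have n: "cmod (of_real r * (\<i> * cis t)) = r" "cmod (of_real r * cis t) = r"
    using r by (simp_all add: norm_mult)
  show ?thesis
    unfolding geodesic_curvature_def Let_def r_def[symmetric] d1 d2 i1 i2 n
    using r by (simp add: field_simps power2_eq_square power3_eq_cube)
qed

lemma cmod_perp_circle:
  "(cmod (perp_circle k0 x t))\<^sup>2 =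
     (perp_centre k0 x)\<^sup>2 + (perp_radius k0 x)\<^sup>2 - 2 * perp_centre k0 x * perp_radius k0 x * cos t"
proof -
  have "Re (perp_circle k0 x t) = perp_centre k0 x - perp_radius k0 x * cos t"
    "Im (perp_circle k0 x t) = - (perp_radius k0 x * sin t)"
    by (simp_all add: perp_circle_def)
  then show ?thesis
    by (simp add: cmod_power2 power2_diff power_mult_distrib sin_squared_eq right_diff_distrib)
qed

lemma vector_derivative_perp_circle:
  "vector_derivative (perp_circle k0 x) (at t) = - (of_real (perp_radius k0 x) * (\<i> * cis t))"
  using has_vector_derivative_cis_scaled[of "of_real (perp_centre k0 x)" "- of_real (perp_radius k0 x)" t]
  by (simp add: vector_derivative_at perp_circle_def[abs_def])

lemma perp_circle_geodesic_curvature: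
  assumes "1 < k0" "0 < x"
  shows "geodesic_curvature (perp_circle k0 x) t = x"
proof -
  define s where "s = perp_radius k0 x"
  define c where "c = perp_centre k0 x"
  have s: "0 < s" and c2: "c\<^sup>2 = 1 - 2 * s * x + s\<^sup>2"
    using perp_radius_pos[OF assms] by (auto simp: s_def c_def perp_centre_def)
  have d2: "vector_derivative (\<lambda>u. - (of_real s * (\<i> * cis u))) (at t) = of_real s * cis t"
    using has_vector_derivative_cis_scaled[of 0 "- (of_real s * \<i>)" t]
    by (simp add: vector_derivative_at mult.assoc)
  have sc: "sin t * sin t + cos t * cos t = 1"
    using sin_cos_squared_add[of t] by (simp add: power2_eq_square)
  have i1: "Im (cnj (- (of_real s * (\<i> * cis t))) * (of_real s * cis t)) = s\<^sup>2"
    using sc by (simp add: power2_eq_square algebra_simps flip: distrib_left)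
  have "Im (cnj (of_real c - of_real s * cis t) * (- (of_real s * (\<i> * cis t)))) =
      s\<^sup>2 * (sin t * sin t + cos t * cos t) - s * c * cos t"
    by (simp add: power2_eq_square algebra_simps del: sin_cos_squared_add3)
  then have i2: "Im (cnj (of_real c - of_real s * cis t) * (- (of_real s * (\<i> * cis t)))) = s\<^sup>2 - s * c * cos t"
    unfolding sc by simp
  have n: "cmod (- (of_real s * (\<i> * cis t))) = s" using s by (simp add: norm_mult)
  have m: "(cmod (of_real c - of_real s * cis t))\<^sup>2 = c\<^sup>2 + s\<^sup>2 - 2 * c * s * cos t"
    using cmod_perp_circle[of k0 x t] by (simp add: perp_circle_def s_def c_def)
  have "geodesic_curvature (perp_circle k0 x) t =
      (1 - (c\<^sup>2 + s\<^sup>2 - 2 * c * s * cos t)) / 2 * (s\<^sup>2 / s ^ 3) + (s\<^sup>2 - s * c * cos t) / s"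
    unfolding geodesic_curvature_def Let_def vector_derivative_perp_circle s_def[symmetric] d2 i1 n
    unfolding perp_circle_def s_def[symmetric] c_def[symmetric] i2 m ..
  also have "\<dots> = x"
    unfolding c2 using s by (simp add: field_simps power2_eq_square power3_eq_cube)
  finally show ?thesis .
qed

text \<open>At an intersection point \<open>z\<close> of the two circles the Euclidean radii are perpendicular, hence so
  are the circles.\<close>

lemma perp_circle_perpendicular:
  assumes "cmod z = dual_radius k0" "cmod (z - of_real (perp_centre k0 x)) = perp_radius k0 x"
  shows "Re (cnj z * (z - of_real (perp_centre k0 x))) = 0"
proof -
  define c where "c = perp_centre k0 x"
  have c2: "c\<^sup>2 = (cmod z)\<^sup>2 + (cmod (z - of_real c))\<^sup>2"
    unfolding c_def assms by (simp add: perp_centre_def)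
  then have "c\<^sup>2 = (Re z)\<^sup>2 + (Im z)\<^sup>2 + ((Re z - c)\<^sup>2 + (Im z)\<^sup>2)" by (simp add: cmod_power2)
  then have "Re z * (Re z - c) + Im z * Im z = 0" by algebra
  then show ?thesis unfolding c_def[symmetric] by simp
qed

lemma half_arc_bounds:
  assumes "1 < k0" "0 < x"
  shows "0 < half_arc k0 x" "half_arc k0 x < pi / 2" "0 < perp_centre k0 x"
    "cos (half_arc k0 x) = perp_radius k0 x / perp_centre k0 x"
    "sin (half_arc k0 x) = dual_radius k0 / perp_centre k0 x"
proof -
  define r where "r = dual_radius k0"
  define s where "s = perp_radius k0 x"
  define c where "c = perp_centre k0 x"
  have r: "0 < r" and s: "0 < s" and c_def': "c = sqrt (r\<^sup>2 + s\<^sup>2)"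
    using dual_radius_bounds[OF assms(1)] perp_radius_pos[OF assms]
    by (auto simp: r_def s_def c_def perp_centre_def)
  show "0 < half_arc k0 x" using r s by (simp add: half_arc_def r_def s_def)
  show "half_arc k0 x < pi / 2" unfolding half_arc_def by (rule arctan_ubound)
  have c: "0 < c" using r s by (simp add: c_def' add_pos_pos)
  then show "0 < perp_centre k0 x" by (simp add: c_def)
  have "1 + (r / s)\<^sup>2 = (r\<^sup>2 + s\<^sup>2) / s\<^sup>2" using s by (simp add: field_simps)
  then have q: "sqrt (1 + (r / s)\<^sup>2) = c / s"
    using s by (simp add: c_def' real_sqrt_divide)
  show "cos (half_arc k0 x) = perp_radius k0 x / perp_centre k0 x"
    unfolding half_arc_def r_def[symmetric] s_def[symmetric] c_def[symmetric] cos_arctan q by simp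
  show "sin (half_arc k0 x) = dual_radius k0 / perp_centre k0 x"
    unfolding half_arc_def r_def[symmetric] s_def[symmetric] c_def[symmetric] sin_arctan q
    using s by simp
qed

lemma perp_circle_in_dual_disc_iff:
  assumes "1 < k0" "0 < x" "\<bar>t\<bar> \<le> pi"
  shows "cmod (perp_circle k0 x t) \<le> dual_radius k0 \<longleftrightarrow> \<bar>t\<bar> \<le> half_arc k0 x"
proof -
  define r where "r = dual_radius k0"
  define s where "s = perp_radius k0 x"
  define c where "c = perp_centre k0 x"
  note hb = half_arc_bounds[OF assms(1,2)]
  have r: "0 < r" and s: "0 < s" and c: "0 < c" and c2: "c\<^sup>2 = r\<^sup>2 + s\<^sup>2"
    using dual_radius_bounds[OF assms(1)] perp_radius_pos[OF assms(1,2)] hb(3)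
    by (auto simp: r_def s_def c_def perp_centre_def)
  have m: "(cmod (perp_circle k0 x t))\<^sup>2 = r\<^sup>2 + 2 * s * (s - c * cos t)"
    unfolding cmod_perp_circle s_def[symmetric] c_def[symmetric] c2
    by (simp add: power2_eq_square algebra_simps)
  have "cmod (perp_circle k0 x t) \<le> r \<longleftrightarrow> (cmod (perp_circle k0 x t))\<^sup>2 \<le> r\<^sup>2"
    using r by (simp add: power_mono_iff)
  also have "\<dots> \<longleftrightarrow> s - c * cos t \<le> 0" unfolding m using s by (simp add: mult_le_0_iff)
  also have "\<dots> \<longleftrightarrow> s / c \<le> cos t" using s c by (simp add: field_simps)
  also have "\<dots> \<longleftrightarrow> cos (half_arc k0 x) \<le> cos \<bar>t\<bar>" using hb by (simp add: s_def c_def)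
  also have "\<dots> \<longleftrightarrow> \<bar>t\<bar> \<le> half_arc k0 x"
    using hb assms(3) by (intro cos_mono_le_eq) auto
  finally show ?thesis by (simp add: r_def)
qed

lemma perp_circle_end_points:
  assumes "1 < k0" "0 < x"
  shows "perp_circle k0 x (- half_arc k0 x) = of_real (dual_radius k0) * cis (central_angle k0 x / 2)"
    "perp_circle k0 x (half_arc k0 x) = of_real (dual_radius k0) * cis (- central_angle k0 x / 2)"
proof -
  define r where "r = dual_radius k0"
  define s where "s = perp_radius k0 x"
  define c where "c = perp_centre k0 x"
  note hb = half_arc_bounds[OF assms]
  have r: "0 < r" and s: "0 < s" and c: "0 < c" and c2: "c\<^sup>2 = r\<^sup>2 + s\<^sup>2" and c3: "sqrt (r\<^sup>2 + s\<^sup>2) = c"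
    and sx: "1 - r\<^sup>2 = 2 * s * x"
    using dual_radius_bounds[OF assms(1)] perp_radius_pos[OF assms] hb(3)
    by (auto simp: r_def s_def c_def perp_centre_def)
  have "sqrt (k0\<^sup>2 - 1) / x = s / r"
    unfolding dual_radius_bounds(4)[OF assms(1)] r_def[symmetric] sx using assms r by (simp add: field_simps)
  then have th: "central_angle k0 x / 2 = arctan (s / r)" by (simp add: central_angle_def)
  have "1 + (s / r)\<^sup>2 = (r\<^sup>2 + s\<^sup>2) / r\<^sup>2" using r by (simp add: field_simps)
  then have q: "sqrt (1 + (s / r)\<^sup>2) = c / r" using r c3 by (simp add: real_sqrt_divide)
  have cs: "cos (central_angle k0 x / 2) = r / c" "sin (central_angle k0 x / 2) = s / c"
    unfolding th cos_arctan sin_arctan q using r by simp_all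
  have *: "c - s * s / c = r * r / c" using c c2 by (simp add: field_simps power2_eq_square)
  show "perp_circle k0 x (- half_arc k0 x) = of_real (dual_radius k0) * cis (central_angle k0 x / 2)"
    unfolding perp_circle_def r_def[symmetric] s_def[symmetric] c_def[symmetric]
    using hb * by (simp add: complex_eq_iff cs flip: r_def s_def c_def)
  show "perp_circle k0 x (half_arc k0 x) = of_real (dual_radius k0) * cis (- central_angle k0 x / 2)"
    unfolding perp_circle_def r_def[symmetric] s_def[symmetric] c_def[symmetric]
    using hb * by (simp add: complex_eq_iff cs flip: r_def s_def c_def)
qed

lemma arc_length_integrand:
  assumes "1 < k0" "0 < x"
  shows "2 * cmod (vector_derivative (perp_circle k0 x) (at t)) / (1 - (cmod (perp_circle k0 x t))\<^sup>2) =
     1 / (x - perp_radius k0 x + perp_centre k0 x * cos t)"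
proof -
  define s where "s = perp_radius k0 x"
  define c where "c = perp_centre k0 x"
  have s: "0 < s" and c2: "c\<^sup>2 = 1 - 2 * s * x + s\<^sup>2"
    using perp_radius_pos[OF assms] by (auto simp: s_def c_def perp_centre_def)
  have "1 - (c\<^sup>2 + s\<^sup>2 - 2 * c * s * cos t) = 2 * s * (x - s + c * cos t)"
    unfolding c2 by (simp add: power2_eq_square algebra_simps)
  then show ?thesis
    unfolding vector_derivative_perp_circle cmod_perp_circle s_def[symmetric] c_def[symmetric]
    using s by (simp add: norm_mult)
qed

text \<open>The primitive used is \<open>P (sin t / (c + a cos t))\<close> with
  \<open>P u = \<integral>du / (1 + (x\<^sup>2 - 1) u\<^sup>2)\<close>, where \<open>a = x - s\<close> and \<open>s\<close>, \<open>c\<close> are the Euclidean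
  radius and centre; note \<open>a\<^sup>2 - c\<^sup>2 = x\<^sup>2 - 1\<close>.\<close>

lemma arc_length_primitive:
  assumes k: "1 < k0" "0 < x"
    and P: "\<And>u. \<bar>u\<bar> \<le> 1 / k0 \<Longrightarrow> (P has_real_derivative 1 / (1 + (x\<^sup>2 - 1) * u\<^sup>2)) (at u)"
    and odd: "P (- (1 / k0)) = - P (1 / k0)"
  shows "arc_length k0 x = 2 * P (1 / k0)"
proof -
  define r where "r = dual_radius k0"
  define s where "s = perp_radius k0 x"
  define c where "c = perp_centre k0 x"
  define a where "a = x - s"
  define h where "h = half_arc k0 x"
  define g where "g = (\<lambda>t. sin t / (c + a * cos t))"
  note hb = half_arc_bounds[OF k]
  have r: "0 < r" and s: "0 < s" and c: "0 < c" and c2: "c\<^sup>2 = r\<^sup>2 + s\<^sup>2"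
    and sx: "1 - r\<^sup>2 = 2 * s * x" and k0: "k0 = (1 + r\<^sup>2) / (2 * r)"
    using dual_radius_bounds[OF k(1)] perp_radius_pos[OF k] hb(3)
    by (auto simp: r_def s_def c_def perp_centre_def)
  have h: "0 < h" "h < pi / 2" "cos h = s / c" "sin h = r / c"
    using hb by (auto simp: h_def s_def c_def r_def)
  have "s\<^sup>2 < c\<^sup>2" using c2 r by simp
  then have "s < c" using c by (meson less_imp_le power2_less_imp_less)
  have ac: "a\<^sup>2 - c\<^sup>2 = x\<^sup>2 - 1" 
  proof -
    have "a\<^sup>2 = x\<^sup>2 - 2 * s * x + s\<^sup>2" by (simp add: a_def power2_diff)
    then show ?thesis using c2 sx by linarith
  qed
  have cosb: "s / c \<le> cos t" if "t \<in> {-h..h}" for t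
  proof -
    have "cos h \<le> cos \<bar>t\<bar>" using that h by (intro cos_monotone_0_pi_le) auto
    then show ?thesis using h by simp
  qed
  have pos1: "0 < c + a * cos t" if "t \<in> {-h..h}" for t
  proof (cases "0 \<le> a")
    case True
    have "0 \<le> cos t" using cosb[OF that] s c by (meson divide_pos_pos less_eq_real_def order.trans)
    then show ?thesis using True c by (simp add: add_pos_nonneg)
  next
    case False
    then have "a * 1 \<le> a * cos t" by (intro mult_left_mono_neg) auto
    then show ?thesis using \<open>s < c\<close> k by (simp add: a_def)
  qed
  have pos2: "0 < a + c * cos t" if "t \<in> {-h..h}" for t
  proof -
    have "s \<le> c * cos t" using cosb[OF that] c by (simp add: field_simps)
    then show ?thesis using k by (simp add: a_def)
  qed
  have dg: "(g has_real_derivative (a + c * cos t) / (c + a * cos t)\<^sup>2) (at t)" if "t \<in> {-h..h}" for t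
  proof -
    have "(g has_real_derivative
        (cos t * (c + a * cos t) - sin t * (a * (- sin t))) / ((c + a * cos t) * (c + a * cos t))) (at t)"
      unfolding g_def using pos1[OF that] by (auto intro!: derivative_eq_intros)
    moreover have "cos t * (c + a * cos t) - sin t * (a * (- sin t)) = c * cos t + a * ((cos t)\<^sup>2 + (sin t)\<^sup>2)"
      by (simp add: power2_eq_square algebra_simps del: sin_cos_squared_add3)
    ultimately show ?thesis by (simp add: power2_eq_square add.commute)
  qed
  have gh: "g h = 1 / k0" "g (- h) = - (1 / k0)"
  proof -
    have "c + a * cos h = (c\<^sup>2 + a * s) / c" using c h by (simp add: field_simps power2_eq_square)
    also have "c\<^sup>2 + a * s = (1 + r\<^sup>2) / 2"
    proof -
      have "2 * (a * s) = 2 * s * x - 2 * s\<^sup>2" by (simp add: a_def power2_eq_square algebra_simps)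
      then have "2 * (c\<^sup>2 + a * s) = 1 + r\<^sup>2" unfolding c2 using sx by algebra
      then show ?thesis by simp
    qed
    finally have "c + a * cos h = (1 + r\<^sup>2) / 2 / c" .
    then show "g h = 1 / k0" using c h by (simp add: g_def k0)
    then show "g (- h) = - (1 / k0)" by (simp add: g_def)
  qed
  have gmono: "g u \<le> g v" if "-h \<le> u" "u \<le> v" "v \<le> h" for u v
  proof (rule DERIV_nonneg_imp_nondecreasing[OF \<open>u \<le> v\<close>])
    fix t assume t: "u \<le> t" "t \<le> v"
    then have "t \<in> {-h..h}" using that by auto
    then show "\<exists>y. (g has_real_derivative y) (at t) \<and> 0 \<le> y"
      using dg pos2 by (meson divide_nonneg_nonneg less_eq_real_def zero_le_power2)
  qed
  have gb: "\<bar>g t\<bar> \<le> 1 / k0" if "t \<in> {-h..h}" for t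
    using gmono[of "-h" t] gmono[of t h] gh that by auto
  have dPg: "((\<lambda>t. P (g t)) has_real_derivative 1 / (a + c * cos t)) (at t)" if "t \<in> {-h..h}" for t
  proof -
    have "((\<lambda>t. P (g t)) has_real_derivative
        1 / (1 + (x\<^sup>2 - 1) * (g t)\<^sup>2) * ((a + c * cos t) / (c + a * cos t)\<^sup>2)) (at t)"
      using DERIV_chain2[OF P[OF gb[OF that]] dg[OF that]] .
    moreover have "1 / (1 + (x\<^sup>2 - 1) * (g t)\<^sup>2) * ((a + c * cos t) / (c + a * cos t)\<^sup>2) = 1 / (a + c * cos t)"
    proof -
      define w where "w = c + a * cos t"
      define y where "y = a + c * cos t"
      have w: "0 < w" and y: "0 < y" using pos1 pos2 that by (auto simp: w_def y_def)
      have "w\<^sup>2 + (x\<^sup>2 - 1) * (sin t)\<^sup>2 = y\<^sup>2"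
        unfolding ac[symmetric] w_def y_def sin_squared_eq by (simp add: power2_eq_square algebra_simps)
      then have "1 + (x\<^sup>2 - 1) * (g t)\<^sup>2 = y\<^sup>2 / w\<^sup>2"
        using w by (simp add: g_def w_def[symmetric] field_simps)
      then show ?thesis
        unfolding w_def[symmetric] y_def[symmetric] using w y by (simp add: power2_eq_square)
    qed
    ultimately show ?thesis by simp
  qed
  have "((\<lambda>t. 1 / (a + c * cos t)) has_integral P (g h) - P (g (- h))) {-h..h}"
    using h dPg by (intro fundamental_theorem_of_calculus)
      (auto simp: has_real_derivative_iff_has_vector_derivative[symmetric]
        intro: has_field_derivative_at_within)
  then have "integral {-h..h} (\<lambda>t. 1 / (a + c * cos t)) = 2 * P (1 / k0)"
    unfolding gh odd by (simp add: integral_unique)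
  then show ?thesis
    unfolding arc_length_def hyp_length_def arc_length_integrand[OF k]
    by (simp add: a_def s_def c_def h_def)
qed

lemma arc_curvature_explicit:
  assumes "1 < k0" "0 < x"
  shows "x * arc_length k0 x =
    (if 1 < x then 2 * x / sqrt (x\<^sup>2 - 1) * arctan (sqrt (x\<^sup>2 - 1) / k0)
     else if x = 1 then 2 / k0
     else 2 * x / sqrt (1 - x\<^sup>2) * artanh (sqrt (1 - x\<^sup>2) / k0))"
proof -
  consider "1 < x" | "x = 1" | "x < 1" by linarith
  then show ?thesis
  proof cases
    case 1
    define d where "d = sqrt (x\<^sup>2 - 1)"
    have "1 < x\<^sup>2" using 1 by (simp add: one_less_power)
    then have d: "0 < d" "d\<^sup>2 = x\<^sup>2 - 1" by (auto simp: d_def)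
    have "arc_length k0 x = 2 * (arctan (d * (1 / k0)) / d)"
    proof (rule arc_length_primitive[OF assms])
      show "((\<lambda>u. arctan (d * u) / d) has_real_derivative 1 / (1 + (x\<^sup>2 - 1) * u\<^sup>2)) (at u)" for u
        unfolding d(2)[symmetric] using d(1)
        by (auto intro!: derivative_eq_intros simp: power_mult_distrib divide_inverse)
    qed (simp add: arctan_minus)
    then show ?thesis using 1 by (simp add: d_def)
  next
    case 2
    have "arc_length k0 x = 2 * (1 / k0)"
      by (rule arc_length_primitive[OF assms, where P = "\<lambda>u. u"]) (auto simp: 2)
    then show ?thesis by (simp add: 2)
  next
    case 3
    define d where "d = sqrt (1 - x\<^sup>2)"
    have "x\<^sup>2 < 1" using 3 assms by (simp add: power_less_one_iff)
    then have d: "0 < d" "d\<^sup>2 = 1 - x\<^sup>2" "d < 1" using assms by (auto simp: d_def)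
    have "arc_length k0 x = 2 * (artanh (d * (1 / k0)) / d)"
    proof (rule arc_length_primitive[OF assms])
      fix u :: real assume u: "\<bar>u\<bar> \<le> 1 / k0"
      have "1 / k0 < 1" using assms by simp
      then have "\<bar>d * u\<bar> < 1 * 1" unfolding abs_mult using u d by (intro mult_strict_mono') auto
      then have b: "\<bar>d * u\<bar> < 1" by simp
      have "((\<lambda>u. artanh (d * u) / d) has_real_derivative (1 / (1 - (d * u)\<^sup>2)) * d / d) (at u)"
        by (intro DERIV_cdivide DERIV_cmult_Id
            DERIV_chain2[where f = artanh and g = "\<lambda>u. d * u", OF artanh_real_has_field_derivative[OF b]])
      moreover have "1 - (d * u)\<^sup>2 = 1 + (x\<^sup>2 - 1) * u\<^sup>2"
        unfolding power_mult_distrib d(2) by (simp add: algebra_simps)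
      ultimately show "((\<lambda>u. artanh (d * u) / d) has_real_derivative 1 / (1 + (x\<^sup>2 - 1) * u\<^sup>2)) (at u)"
        using d(1) by simp
    next
      have "d * (1 / k0) < 1 * 1" using assms d by (intro mult_strict_mono') auto
      moreover have "0 < d * (1 / k0)" using assms d by simp
      ultimately show "artanh (d * (- (1 / k0))) / d = - (artanh (d * (1 / k0)) / d)"
        using artanh_minus_real[of "d * (1 / k0)"] by simp
    qed
    then show ?thesis using 3 by (simp add: d_def)
  qed
qed


section \<open>Generalized circle packing metrics\<close>

text \<open>The metric is described by the geodesic curvatures \<open>k v\<close> of the generalized circles and
  \<open>kf f\<close> of the dual circles.  The conical polygon of \<open>f\<close> is glued cyclically from the quadrilaterals
  of the perpendicular pairs \<open>(kf f, k v)\<close>, \<open>v \<in> face_vertices S V f\<close>; consecutive generalized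
  circles are then tangent, both being perpendicular to the dual circle at a common point.  The sides of
  the polygons have lengths depending only on the curvatures at their end points, so the polygons of
  adjacent faces fit together for every choice of \<open>k\<close> and \<open>kf\<close>.  Conversely \<open>kf\<close> is determined by
  \<open>k\<close> and the cone angles, so for prescribed discrete curvature the metrics are parametrized
  by \<open>k\<close>.\<close>

definition gcp_metric :: "'a set \<Rightarrow> 'a set set \<Rightarrow> ('a \<Rightarrow> real) \<Rightarrow> ('a set \<Rightarrow> real) \<Rightarrow> bool" where
  "gcp_metric V F k kf \<longleftrightarrow> (\<forall>v\<in>V. 0 < k v) \<and> (\<forall>f\<in>F. 1 < kf f)"

definition cone_angle ::
    "'a topology \<Rightarrow> 'a set \<Rightarrow> ('a \<Rightarrow> real) \<Rightarrow> ('a set \<Rightarrow> real) \<Rightarrow> 'a set \<Rightarrow> real" where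
  "cone_angle S V k kf f = (\<Sum>v\<in>face_vertices S V f. central_angle (kf f) (k v))"

definition discrete_curvature ::
    "'a topology \<Rightarrow> 'a set \<Rightarrow> ('a \<Rightarrow> real) \<Rightarrow> ('a set \<Rightarrow> real) \<Rightarrow> 'a set \<Rightarrow> real" where
  "discrete_curvature S V k kf f = 2 * pi - cone_angle S V k kf f"

definition total_geodesic_curvature ::
    "'a topology \<Rightarrow> 'a set \<Rightarrow> 'a set set \<Rightarrow> ('a \<Rightarrow> real) \<Rightarrow> ('a set \<Rightarrow> real) \<Rightarrow> 'a \<Rightarrow> real" where
  "total_geodesic_curvature S V F k kf v =
     (\<Sum>f | f \<in> F \<and> v \<in> face_vertices S V f. k v * arc_length (kf f) (k v))"

definition admissible_curvatures ::
    "'a topology \<Rightarrow> 'a set \<Rightarrow> 'a set set \<Rightarrow> ('a set \<Rightarrow> real) \<Rightarrow> ('a \<Rightarrow> real) set" where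
  "admissible_curvatures S V F Y =
     {L. (\<forall>v\<in>V. 0 < L v) \<and>
         (\<forall>W. W \<subseteq> V \<and> W \<noteq> {} \<longrightarrow>
            (\<Sum>w\<in>W. L w) <
            (\<Sum>f\<in>faces_meeting S V F W.
               pi * min (real (card (W \<inter> face_vertices S V f)))
                        (real (card (face_vertices S V f)) - 2 + Y f / pi)))}"

end

theory Submission
  imports Defs
begin

text \<open>In the variables \<open>u = ln k\<^sub>v\<close> and \<open>s = arcosh k\<^sub>f\<close> the total curvature of the arc and the central
  angle satisfy \<open>\<partial>\<^sub>s L = \<partial>\<^sub>u \<theta>\<close>, so \<open>L du + \<theta> ds\<close> has a potential \<open>\<Phi>\<close>, and \<open>\<Phi>\<close> is strictly convex on the whole
  plane. Packings with prescribed data are the critical points of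
  \<open>\<Sum> \<Phi>(u\<^sub>v, s\<^sub>f) - \<Sum> L\<^sub>v u\<^sub>v - \<Sum> (2 \<pi> - Y\<^sub>f) s\<^sub>f\<close>, which gives uniqueness. Since \<open>\<Phi>\<close> grows like
  \<open>\<pi> max(u, \<bar>s\<bar>, 0)\<close>, decomposing along superlevel sets of \<open>(u, s)\<close> shows that the inequalities
  over all \<open>W\<close> are what coercivity requires, and a minimiser exists. They are necessary because
  \<open>L\<^sub>v\<^sub>,\<^sub>f < \<pi> - \<theta>\<^sub>v\<^sub>,\<^sub>f\<close> by Gauss-Bonnet.\<close>

section \<open>Arc curvature and sector angle in logarithmic coordinates\<close>

text \<open>The condition \<open>1 < kf f\<close> confines \<open>s\<close> to a half-plane, where a
  minimising sequence could run into the boundary. Continuing the arc curvature evenly and the angle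
  oddly in \<open>s\<close> removes that boundary. Nothing is lost: a minimiser has
  \<open>s > 0\<close> at every face by itself, since angles at a face with \<open>s \<le> 0\<close>
  are nonpositive and cannot add up to a positive cone angle. Treating the
  \<open>s\<close>-coordinates as free variables beside the \<open>u\<close>-coordinates also avoids
  solving the cone angle equation for the dual circles implicitly; it becomes one more critical
  point equation. The minimum in the admissibility condition comes from superlevel sets. Once the
  vertex part \<open>W\<close> of such a set is fixed, each face may independently belong to the set
  or not, and contributes the total angle \<pi> N(f) less its cone angle, or \<pi> N(f,W); the less
  favourable choice is the minimum. Towards u = -\<infinity> the potential is nearly flat, and there
  the linear term with \<open>L v > 0\<close> takes over.\<close>

text \<open>The integral covers circles, horocycles and hypercycles at once, and is smooth in both variables,
  also across \<open>s = 0\<close>.\<close>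

definition arc_curvature :: "real \<Rightarrow> real \<Rightarrow> real" where
  "arc_curvature u s =
     integral {0..1} (\<lambda>t. 2 * exp u * cosh s / ((cosh s)\<^sup>2 + ((exp u)\<^sup>2 - 1) * t\<^sup>2))"

text \<open>For \<open>s = arcosh k0\<close> the root \<open>sqrt (k0\<^sup>2 - 1)\<close> is
  \<open>sinh s\<close>, which continues to negative \<open>s\<close> as an odd function.\<close>

definition sector_angle :: "real \<Rightarrow> real \<Rightarrow> real" where
  "sector_angle u s = 2 * arctan (sinh s / exp u)"

text \<open>The derivative of \<open>arc_curvature\<close> in \<open>u\<close>, integrated by parts so that the Hessian of the potential
  becomes a square plus a positive integral.\<close>

definition arc_curvature_du :: "real \<Rightarrow> real \<Rightarrow> real" where
  "arc_curvature_du u s =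
     2 * exp u * (sinh s)\<^sup>2 / (cosh s * ((exp u)\<^sup>2 + (sinh s)\<^sup>2)) +
     integral {0..1} (\<lambda>t. 2 * exp u * t\<^sup>2 / (cosh s * ((cosh s)\<^sup>2 + ((exp u)\<^sup>2 - 1) * t\<^sup>2)))"

text \<open>Hypercycles make the coefficient \<open>x\<^sup>2 - 1\<close> negative;
  \<open>t \<le> 1 \<le> k\<close> compensates for it.\<close>

lemma arc_denominator_pos:
  fixes k x t :: real
  assumes "1 \<le> k" "0 < x" "t \<in> {0..1}"
  shows "0 < k\<^sup>2 + (x\<^sup>2 - 1) * t\<^sup>2"
proof (cases "t = 0")
  case True
  then show ?thesis using assms by simp
next
  case False
  have "t\<^sup>2 \<le> k\<^sup>2" using assms by (intro power_mono) auto
  moreover have "0 < x\<^sup>2 * t\<^sup>2" using False assms by simp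
  ultimately show ?thesis by (simp add: left_diff_distrib)
qed

lemma cosh_denominator_pos:
  fixes u s t :: real
  assumes "t \<in> {0..1}"
  shows "0 < (cosh s)\<^sup>2 + ((exp u)\<^sup>2 - 1) * t\<^sup>2"
  by (rule arc_denominator_pos) (use assms cosh_real_ge_1 in auto)

lemma cosh_denominator_nonzero:
  fixes u s t :: real
  assumes "0 \<le> t" "t \<le> 1"
  shows "(cosh s)\<^sup>2 + ((exp u)\<^sup>2 - 1) * t\<^sup>2 \<noteq> 0"
  using cosh_denominator_pos[of t s u] assms by simp

section \<open>Partial derivatives of arc curvature and angle\<close>

lemma arc_curvature_deriv_s:
  "((\<lambda>s. arc_curvature u s) has_real_derivative
     - (2 * exp u * sinh s / ((exp u)\<^sup>2 + (sinh s)\<^sup>2))) (at s)"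
proof -
  define x where "x = exp u"
  define dn where "dn = (\<lambda>s t. (cosh s)\<^sup>2 + (x\<^sup>2 - 1) * t\<^sup>2 :: real)"
  have dn: "dn s t \<noteq> 0" if "0 \<le> t" "t \<le> 1" for s t
    unfolding dn_def x_def by (rule cosh_denominator_nonzero[OF that])
  define f where "f = (\<lambda>s t. 2 * x * cosh s / dn s t)"
  define f' where "f' = (\<lambda>s t. 2 * x * sinh s * (dn s t - 2 * (cosh s)\<^sup>2) / (dn s t)\<^sup>2)"
  have "((\<lambda>s. integral (cbox 0 1) (f s)) has_field_derivative integral (cbox 0 1) (f' s)) (at s within UNIV)"
  proof (rule leibniz_rule_field_derivative)
    fix s t :: real assume "t \<in> cbox 0 1"
    then have nz: "dn s t \<noteq> 0" by (intro dn) auto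
    have D: "((\<lambda>s. dn s t) has_field_derivative 2 * cosh s * sinh s) (at s)"
      unfolding dn_def by (auto intro!: derivative_eq_intros)
    have N: "((\<lambda>s. 2 * x * cosh s) has_field_derivative 2 * x * sinh s) (at s)"
      by (auto intro!: derivative_eq_intros)
    show "((\<lambda>s. f s t) has_field_derivative f' s t) (at s within UNIV)"
      unfolding f_def f'_def
      by (rule DERIV_cong[OF DERIV_divide[OF N D nz]]) (simp add: power2_eq_square algebra_simps)
  next
    fix s show "f s integrable_on cbox 0 1"
      unfolding f_def by (intro integrable_continuous continuous_intros)
        (auto simp: dn, auto simp: dn_def intro!: continuous_intros)
  next
    show "continuous_on (UNIV \<times> cbox 0 1) (\<lambda>(s, t). f' s t)"
      unfolding f'_def split_beta by (intro continuous_intros)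
        (auto simp: dn, auto simp: dn_def intro!: continuous_intros)
  qed auto
  \<comment> \<open>The integrand is homogeneous of degree -1 in \<open>cosh s\<close> and
    \<open>t\<close>. By Euler's identity its derivative in \<open>cosh s\<close> is therefore an
    exact derivative in \<open>t\<close>, that of \<open>- (2 * x * t / dn s t)\<close>, and only
    the value at \<open>t = 1\<close> survives.\<close>
  moreover have "(f' s has_integral - (2 * x * sinh s * 1 / dn s 1) - - (2 * x * sinh s * 0 / dn s 0)) {0..1}"
  proof (rule fundamental_theorem_of_calculus)
    fix t :: real assume "t \<in> {0..1}"
    then have nz: "dn s t \<noteq> 0" by (intro dn) auto
    have D: "((\<lambda>t. dn s t) has_field_derivative (x\<^sup>2 - 1) * (2 * t)) (at t within {0..1})"
      unfolding dn_def by (auto intro!: derivative_eq_intros)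
    have N: "((\<lambda>t. 2 * x * sinh s * t) has_field_derivative 2 * x * sinh s) (at t within {0..1})"
      by (auto intro!: derivative_eq_intros)
    have e: "- ((2 * x * sinh s * dn s t - 2 * x * sinh s * t * ((x\<^sup>2 - 1) * (2 * t))) / (dn s t * dn s t)) = f' s t"
      unfolding f'_def minus_divide_left by (rule arg_cong2[where f = "(/)"])
        (simp_all add: dn_def power2_eq_square algebra_simps)
    show "((\<lambda>t. - (2 * x * sinh s * t / dn s t)) has_vector_derivative f' s t) (at t within {0..1})"
      unfolding has_real_derivative_iff_has_vector_derivative[symmetric]
      by (rule DERIV_cong[OF DERIV_minus[OF DERIV_divide[OF N D nz]] e])
  qed simp
  ultimately show ?thesis
    by (simp add: integral_unique f_def dn_def x_def arc_curvature_def[abs_def] cosh_square_eq add.commute)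
qed

lemma arc_curvature_deriv_u:
  "((\<lambda>u. arc_curvature u s) has_real_derivative arc_curvature_du u s) (at u)"
proof -
  define k where "k = cosh s"
  define dn where "dn = (\<lambda>u t. k\<^sup>2 + ((exp u)\<^sup>2 - 1) * t\<^sup>2 :: real)"
  have k: "k \<noteq> 0" by (simp add: k_def)
  have dn: "dn u t \<noteq> 0" if "0 \<le> t" "t \<le> 1" for u t
    unfolding dn_def k_def by (rule cosh_denominator_nonzero[OF that])
  define f where "f = (\<lambda>u t. 2 * exp u * k / dn u t)"
  define f' where "f' = (\<lambda>u t. 2 * exp u * k * (dn u t - 2 * (exp u)\<^sup>2 * t\<^sup>2) / (dn u t)\<^sup>2)"
  define g where "g = (\<lambda>t. 2 * exp u * t\<^sup>2 / (k * dn u t))"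
  have "((\<lambda>u. integral (cbox 0 1) (f u)) has_field_derivative integral (cbox 0 1) (f' u)) (at u within UNIV)"
  proof (rule leibniz_rule_field_derivative)
    fix u t :: real assume "t \<in> cbox 0 1"
    then have nz: "dn u t \<noteq> 0" by (intro dn) auto
    have D: "((\<lambda>u. dn u t) has_field_derivative 2 * (exp u)\<^sup>2 * t\<^sup>2) (at u)"
      unfolding dn_def by (auto intro!: derivative_eq_intros simp: power2_eq_square)
    have N: "((\<lambda>u. 2 * exp u * k) has_field_derivative 2 * exp u * k) (at u)"
      by (auto intro!: derivative_eq_intros)
    show "((\<lambda>u. f u t) has_field_derivative f' u t) (at u within UNIV)"
      unfolding f_def f'_def
      by (rule DERIV_cong[OF DERIV_divide[OF N D nz]]) (simp add: power2_eq_square algebra_simps)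
  next
    fix u show "f u integrable_on cbox 0 1"
      unfolding f_def by (intro integrable_continuous continuous_intros)
        (auto simp: dn, auto simp: dn_def intro!: continuous_intros)
  next
    show "continuous_on (UNIV \<times> cbox 0 1) (\<lambda>(u, t). f' u t)"
      unfolding f'_def split_beta by (intro continuous_intros)
        (auto simp: dn, auto simp: dn_def intro!: continuous_intros)
  qed auto
  \<comment> \<open>The factor \<open>t * (k\<^sup>2 - t\<^sup>2)\<close> vanishes at
    \<open>t = 0\<close> and equals \<open>(sinh s)\<^sup>2\<close> at \<open>t = 1\<close>. It is
    chosen so that the boundary term is the square of the mixed derivative divided by the
    \<open>s\<close>-derivative of the angle; the nonnegative \<open>g\<close> then integrates to
    the Schur complement of the Hessian.\<close>
  moreover have "((\<lambda>t. f' u t - g t) has_integral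
      (2 * exp u / k * (1 * (k\<^sup>2 - 1\<^sup>2) / dn u 1) - 2 * exp u / k * (0 * (k\<^sup>2 - 0\<^sup>2) / dn u 0))) {0..1}"
  proof (rule fundamental_theorem_of_calculus)
    fix t :: real assume "t \<in> {0..1}"
    then have nz: "dn u t \<noteq> 0" by (intro dn) auto
    have D: "((\<lambda>t. dn u t) has_field_derivative ((exp u)\<^sup>2 - 1) * (2 * t)) (at t within {0..1})"
      unfolding dn_def by (auto intro!: derivative_eq_intros)
    have N: "((\<lambda>t. t * (k\<^sup>2 - t\<^sup>2)) has_field_derivative k\<^sup>2 - 3 * t\<^sup>2) (at t within {0..1})"
      by (auto intro!: derivative_eq_intros simp: power2_eq_square)
    have "(k\<^sup>2 - 3 * t\<^sup>2) * dn u t - t * (k\<^sup>2 - t\<^sup>2) * (((exp u)\<^sup>2 - 1) * (2 * t)) =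
        k\<^sup>2 * (dn u t - 2 * (exp u)\<^sup>2 * t\<^sup>2) - t\<^sup>2 * dn u t"
      unfolding dn_def by algebra
    moreover have "f' u t - g t = 2 * exp u / k *
        ((k\<^sup>2 * (dn u t - 2 * (exp u)\<^sup>2 * t\<^sup>2) - t\<^sup>2 * dn u t) / (dn u t * dn u t))"
      unfolding f'_def g_def using nz k by (simp add: field_simps power2_eq_square)
    ultimately have e: "2 * exp u / k * (((k\<^sup>2 - 3 * t\<^sup>2) * dn u t - t * (k\<^sup>2 - t\<^sup>2) * (((exp u)\<^sup>2 - 1) * (2 * t))) / (dn u t * dn u t))
        = f' u t - g t" by simp
    show "((\<lambda>t. 2 * exp u / k * (t * (k\<^sup>2 - t\<^sup>2) / dn u t)) has_vector_derivative f' u t - g t)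
        (at t within {0..1})"
      unfolding has_real_derivative_iff_has_vector_derivative[symmetric]
      by (rule DERIV_cong[OF DERIV_cmult[OF DERIV_divide[OF N D nz]] e])
  qed simp
  moreover have "g integrable_on {0..1}"
    unfolding g_def using k by (intro integrable_continuous_interval continuous_intros)
        (auto simp: dn, auto simp: dn_def intro!: continuous_intros)
  ultimately have D: "((\<lambda>u. integral {0..1} (f u)) has_real_derivative integral {0..1} (f' u)) (at u)"
    and "(f' u has_integral
      (2 * exp u / k * ((k\<^sup>2 - 1) / dn u 1)) + integral {0..1} g) {0..1}"
    using has_integral_add[of "\<lambda>t. f' u t - g t" _ "{0..1}" g] by (auto simp: integrable_integral)
  then have I: "integral {0..1} (f' u) = 2 * exp u / k * ((k\<^sup>2 - 1) / dn u 1) + integral {0..1} g"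
    by (simp add: integral_unique)
  have "2 * exp u / k * ((k\<^sup>2 - 1) / dn u 1) =
      2 * exp u * (sinh s)\<^sup>2 / (cosh s * ((exp u)\<^sup>2 + (sinh s)\<^sup>2))"
    by (simp add: k_def dn_def cosh_square_eq add.commute)
  with D I show ?thesis
    by (simp add: f_def g_def dn_def k_def arc_curvature_def[abs_def] arc_curvature_du_def)
qed

lemma continuous_arc_curvature_du:
  "continuous_on UNIV (\<lambda>(u, s). arc_curvature_du u s)"
proof -
  have "continuous_on UNIV (\<lambda>p::real\<times>real. integral (cbox 0 1)
      (\<lambda>t. 2 * exp (fst p) * t\<^sup>2 / (cosh (snd p) * ((cosh (snd p))\<^sup>2 + ((exp (fst p))\<^sup>2 - 1) * t\<^sup>2))))"
    by (rule integral_continuous_on_param, unfold split_beta, intro continuous_intros)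
      (auto simp: cosh_denominator_nonzero)
  then show ?thesis
    unfolding arc_curvature_du_def split_beta
    by (intro continuous_intros) (auto simp: add_pos_nonneg less_imp_neq[symmetric])
qed

lemma continuous_arc_curvature:
  "continuous_on UNIV (\<lambda>(u, s). arc_curvature u s)"
proof -
  have "continuous_on UNIV (\<lambda>p::real\<times>real. integral (cbox 0 1)
      (\<lambda>t. 2 * exp (fst p) * cosh (snd p) / ((cosh (snd p))\<^sup>2 + ((exp (fst p))\<^sup>2 - 1) * t\<^sup>2)))"
    by (rule integral_continuous_on_param, unfold split_beta, intro continuous_intros)
      (auto simp: cosh_denominator_nonzero)
  then show ?thesis
    unfolding arc_curvature_def split_beta by simp
qed

lemma sector_angle_deriv_u:
  "((\<lambda>u. sector_angle u s) has_real_derivative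
     - (2 * exp u * sinh s / ((exp u)\<^sup>2 + (sinh s)\<^sup>2))) (at u)"
proof -
  have D: "((\<lambda>u. sinh s / exp u) has_real_derivative - (sinh s / exp u)) (at u)"
    by (auto intro!: derivative_eq_intros)
  have "2 * (inverse (1 + (sinh s / exp u)\<^sup>2) * - (sinh s / exp u)) =
      - (2 * exp u * sinh s / ((exp u)\<^sup>2 + (sinh s)\<^sup>2))"
    by (simp add: field_simps power2_eq_square add_nonneg_eq_0_iff)
  with DERIV_cmult[OF DERIV_chain2[OF DERIV_arctan D], of 2] show ?thesis
    unfolding sector_angle_def by simp
qed

lemma sector_angle_deriv_s:
  "((\<lambda>s. sector_angle u s) has_real_derivative
     2 * exp u * cosh s / ((exp u)\<^sup>2 + (sinh s)\<^sup>2)) (at s)"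
proof -
  have D: "((\<lambda>s. sinh s / exp u) has_real_derivative cosh s / exp u) (at s)"
    by (auto intro!: derivative_eq_intros)
  have "2 * (inverse (1 + (sinh s / exp u)\<^sup>2) * (cosh s / exp u)) =
      2 * exp u * cosh s / ((exp u)\<^sup>2 + (sinh s)\<^sup>2)"
    by (simp add: field_simps power2_eq_square add_nonneg_eq_0_iff)
  with DERIV_cmult[OF DERIV_chain2[OF DERIV_arctan D], of 2] show ?thesis
    unfolding sector_angle_def by simp
qed

text \<open>Completing the square leaves a positive multiple of
  \<open>(h * a - k * b)\<^sup>2\<close> plus \<open>J * a\<^sup>2\<close>. The integral
  \<open>J\<close> settles \<open>a \<noteq> 0\<close>; for \<open>a = 0\<close> the square suffices
  because \<open>cosh s\<close> has no zero.\<close>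

lemma arc_curvature_hessian_pos:
  fixes a b u s :: real
  assumes "a \<noteq> 0 \<or> b \<noteq> 0"
  shows "0 < arc_curvature_du u s * a\<^sup>2 + 2 * (- (2 * exp u * sinh s / ((exp u)\<^sup>2 + (sinh s)\<^sup>2))) * a * b +
    2 * exp u * cosh s / ((exp u)\<^sup>2 + (sinh s)\<^sup>2) * b\<^sup>2"
proof -
  define J where "J = integral {0..1} (\<lambda>t. 2 * exp u * t\<^sup>2 / (cosh s * ((cosh s)\<^sup>2 + ((exp u)\<^sup>2 - 1) * t\<^sup>2)))"
  have "integral {0..1} (\<lambda>t::real. 0::real) < J"
    unfolding J_def
  proof (rule integral_less_real)
    show "continuous_on {0..1} (\<lambda>t. 2 * exp u * t\<^sup>2 / (cosh s * ((cosh s)\<^sup>2 + ((exp u)\<^sup>2 - 1) * t\<^sup>2)))"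
      by (intro continuous_intros) (auto simp: cosh_denominator_nonzero)
    fix t :: real assume "t \<in> {0<..<1}"
    then show "0 < 2 * exp u * t\<^sup>2 / (cosh s * ((cosh s)\<^sup>2 + ((exp u)\<^sup>2 - 1) * t\<^sup>2))"
      using cosh_denominator_pos[of t s u] by simp
  qed auto
  then have J: "0 < J" by simp
  define x h k where "x = exp u" and "h = sinh s" and "k = cosh s"
  have x: "0 < x" and k: "0 < k" by (auto simp: x_def k_def)
  define d where "d = x\<^sup>2 + h\<^sup>2"
  have d: "0 < d" using x by (simp add: d_def add_pos_nonneg)
  have "(2 * x * h\<^sup>2 / (k * d) + J) * a\<^sup>2 + 2 * (- (2 * x * h / d)) * a * b + 2 * x * k / d * b\<^sup>2
      = 2 * x / (k * d) * (h * a - k * b)\<^sup>2 + J * a\<^sup>2"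
    using k d by (simp add: field_simps power2_eq_square)
  moreover have "0 < 2 * x / (k * d) * (h * a - k * b)\<^sup>2 + J * a\<^sup>2"
  proof (cases "a = 0")
    case True
    then show ?thesis using assms x k d by simp
  next
    case False
    then show ?thesis using J x k d by (intro add_nonneg_pos) auto
  qed
  ultimately show ?thesis
    by (simp add: arc_curvature_du_def x_def h_def k_def d_def J_def)
qed

section \<open>The convex potential\<close>

text \<open>Convexity is tested along slanted lines, where partial derivatives alone say nothing;
  continuity of \<open>fs\<close> upgrades them to a differential.\<close>

lemma has_derivative_from_partials:
  fixes f fu fs :: "real \<Rightarrow> real \<Rightarrow> real"
  assumes fu: "\<And>u s. ((\<lambda>u. f u s) has_real_derivative fu u s) (at u)"
    and fs: "\<And>u s. ((\<lambda>s. f u s) has_real_derivative fs u s) (at s)"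
    and cont: "continuous_on UNIV (\<lambda>(u, s). fs u s)"
  shows "((\<lambda>p. f (fst p) (snd p)) has_derivative (\<lambda>q. fu u s * fst q + fs u s * snd q)) (at (u, s))"
proof -
  have "((\<lambda>(u, s). f u s) has_derivative (\<lambda>(tu, ts). fu u s * tu + blinfun_mult_right (fs u s) ts))
      (at (u, s) within UNIV \<times> UNIV)" for u s
  proof (rule has_derivative_partialsI)
    show "((\<lambda>u. f u s) has_derivative (*) (fu u s)) (at u)"
      using fu by (simp add: has_field_derivative_def)
    show "((\<lambda>s. f u s) has_derivative blinfun_apply (blinfun_mult_right (fs u s))) (at s)" for u s
      using fs by (simp add: has_field_derivative_def)
    have "continuous_on UNIV (\<lambda>(u, s). blinfun_mult_right (fs u s))"
      using cont unfolding split_beta by (intro continuous_intros)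
    then show "continuous (at (u, s) within UNIV \<times> UNIV) (\<lambda>(u, s). blinfun_mult_right (fs u s))"
      by (simp add: continuous_on_eq_continuous_within)
  qed auto
  then show ?thesis
    by (simp add: case_prod_unfold)
qed

lemma line_derivative:
  fixes f fu fs :: "real \<Rightarrow> real \<Rightarrow> real"
  assumes fu: "\<And>u s. ((\<lambda>u. f u s) has_real_derivative fu u s) (at u)"
    and fs: "\<And>u s. ((\<lambda>s. f u s) has_real_derivative fs u s) (at s)"
    and cont: "continuous_on UNIV (\<lambda>(u, s). fs u s)"
  shows "((\<lambda>t. f (u + t * a) (s + t * b)) has_real_derivative
    fu (u + t * a) (s + t * b) * a + fs (u + t * a) (s + t * b) * b) (at t)"
proof -
  have "((\<lambda>t. (u + t * a, s + t * b)) has_derivative (\<lambda>h. (h * a, h * b))) (at t)"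
    by (auto intro!: derivative_eq_intros)
  from has_derivative_compose[OF this has_derivative_from_partials[OF fu fs cont]]
  show ?thesis
    unfolding has_field_derivative_def fst_conv snd_conv
    by (rule has_derivative_eq_rhs) (simp add: fun_eq_iff algebra_simps)
qed

text \<open>The Poincare lemma on the plane: the potential is the radial integral of the form.\<close>

lemma closed_form_potential_deriv:
  fixes f g fu fs :: "real \<Rightarrow> real \<Rightarrow> real"
  assumes fu: "\<And>u s. ((\<lambda>u. f u s) has_real_derivative fu u s) (at u)"
    and fs: "\<And>u s. ((\<lambda>s. f u s) has_real_derivative fs u s) (at s)"
    and gu: "\<And>u s. ((\<lambda>u. g u s) has_real_derivative fs u s) (at u)"
    and cf: "continuous_on UNIV (\<lambda>(u, s). f u s)"
    and cg: "continuous_on UNIV (\<lambda>(u, s). g u s)"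
    and cfu: "continuous_on UNIV (\<lambda>(u, s). fu u s)"
    and cfs: "continuous_on UNIV (\<lambda>(u, s). fs u s)"
  shows "((\<lambda>u. integral {0..1} (\<lambda>t. f (t * u) (t * s) * u + g (t * u) (t * s) * s)) has_real_derivative f u s) (at u)"
proof -
  define D where "D = (\<lambda>u t. f (t * u) (t * s) + t * (fu (t * u) (t * s) * u + fs (t * u) (t * s) * s))"
  have comp: "continuous_on A (\<lambda>x. q (a x) (b x))"
    if "continuous_on UNIV (\<lambda>(u, s). q u s)" "continuous_on A a" "continuous_on A b"
    for q :: "real \<Rightarrow> real \<Rightarrow> real" and A :: "'z::topological_space set" and a b
    using continuous_on_compose2[OF that(1) continuous_on_Pair[OF that(2,3)]] by simp
  have "((\<lambda>u. integral (cbox 0 1) (\<lambda>t. f (t * u) (t * s) * u + g (t * u) (t * s) * s)) has_field_derivative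
      integral (cbox 0 1) (D u)) (at u within UNIV)"
  proof (rule leibniz_rule_field_derivative)
    fix u t :: real
    have f1: "((\<lambda>u. f (t * u) (t * s)) has_real_derivative fu (t * u) (t * s) * t) (at u)"
      by (rule DERIV_chain2[OF fu]) (auto intro!: derivative_eq_intros)
    have g1: "((\<lambda>u. g (t * u) (t * s)) has_real_derivative fs (t * u) (t * s) * t) (at u)"
      by (rule DERIV_chain2[OF gu]) (auto intro!: derivative_eq_intros)
    show "((\<lambda>u. f (t * u) (t * s) * u + g (t * u) (t * s) * s) has_real_derivative D u t) (at u within UNIV)"
      using DERIV_add[OF DERIV_mult[OF f1 DERIV_ident] DERIV_cmult_right[OF g1, of s]]
      by (simp add: D_def algebra_simps)
  next
    fix u show "(\<lambda>t. f (t * u) (t * s) * u + g (t * u) (t * s) * s) integrable_on cbox 0 1"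
      by (intro integrable_continuous continuous_intros comp[OF cf] comp[OF cg])
  next
    show "continuous_on (UNIV \<times> cbox 0 1) (\<lambda>(u, t). D u t)"
      unfolding D_def split_beta
      by (intro continuous_intros comp[OF cf] comp[OF cfu] comp[OF cfs])
  qed auto
  \<comment> \<open>Closedness enters here: \<open>g\<close> has \<open>u\<close>-derivative
    \<open>fs\<close>, so \<open>D u t\<close> is the derivative of
    \<open>t * f (t * u) (t * s)\<close> in \<open>t\<close> and the integral telescopes.\<close>
  moreover have "(D u has_integral 1 * f (1 * u) (1 * s) - 0 * f (0 * u) (0 * s)) {0..1}"
  proof (rule fundamental_theorem_of_calculus)
    fix t :: real
    have f1: "((\<lambda>t. f (t * u) (t * s)) has_real_derivative fu (t * u) (t * s) * u + fs (t * u) (t * s) * s) (at t)"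
      using line_derivative[OF fu fs cfs, of 0 u 0 s t] by simp
    have "((\<lambda>t. t * f (t * u) (t * s)) has_real_derivative D u t) (at t)"
      using DERIV_mult[OF DERIV_ident f1] by (simp add: D_def algebra_simps)
    then show "((\<lambda>t. t * f (t * u) (t * s)) has_vector_derivative D u t) (at t within {0..1})"
      by (simp add: has_real_derivative_iff_has_vector_derivative has_vector_derivative_at_within)
  qed simp
  ultimately show ?thesis
    by (simp add: integral_unique)
qed

lemma closed_form_potential:
  fixes f g fu fs gs :: "real \<Rightarrow> real \<Rightarrow> real"
  assumes fu: "\<And>u s. ((\<lambda>u. f u s) has_real_derivative fu u s) (at u)"
    and fs: "\<And>u s. ((\<lambda>s. f u s) has_real_derivative fs u s) (at s)"
    and gu: "\<And>u s. ((\<lambda>u. g u s) has_real_derivative fs u s) (at u)"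
    and gs: "\<And>u s. ((\<lambda>s. g u s) has_real_derivative gs u s) (at s)"
    and cf: "continuous_on UNIV (\<lambda>(u, s). f u s)"
    and cg: "continuous_on UNIV (\<lambda>(u, s). g u s)"
    and cfu: "continuous_on UNIV (\<lambda>(u, s). fu u s)"
    and cfs: "continuous_on UNIV (\<lambda>(u, s). fs u s)"
    and cgs: "continuous_on UNIV (\<lambda>(u, s). gs u s)"
  obtains \<Phi> where "\<And>u s. ((\<lambda>u. \<Phi> u s) has_real_derivative f u s) (at u)"
    "\<And>u s. ((\<lambda>s. \<Phi> u s) has_real_derivative g u s) (at s)"
proof -
  define \<Phi> where "\<Phi> = (\<lambda>u s. integral {0..1} (\<lambda>t. f (t * u) (t * s) * u + g (t * u) (t * s) * s))"
  have swap: "continuous_on UNIV (\<lambda>(s, u). q u s)"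
    if "continuous_on UNIV (\<lambda>(u, s). q u s)" for q :: "real \<Rightarrow> real \<Rightarrow> real"
    using continuous_on_compose2[OF that continuous_on_swap[of UNIV]] by (simp add: split_beta)
  show ?thesis
  proof
    show "((\<lambda>u. \<Phi> u s) has_real_derivative f u s) (at u)" for u s
      unfolding \<Phi>_def by (rule closed_form_potential_deriv[OF fu fs gu cf cg cfu cfs])
    \<comment> \<open>Exchanging the coordinates together with \<open>f\<close> and \<open>g\<close>
      only swaps the two summands of the radial integral, so the previous case applies
      again.\<close>
    show "((\<lambda>s. \<Phi> u s) has_real_derivative g u s) (at s)" for u s
      using closed_form_potential_deriv[OF gs gu fs swap[OF cg] swap[OF cf] swap[OF cgs] swap[OF cfs], of u s]
      unfolding \<Phi>_def by (simp add: add.commute)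
  qed
qed

lemma continuous_sector_angle:
  "continuous_on UNIV (\<lambda>(u, s). sector_angle u s)"
  unfolding sector_angle_def split_beta by (intro continuous_intros) auto

lemma exp_sinh_squares_nonzero: "(exp u)\<^sup>2 + (sinh s)\<^sup>2 \<noteq> (0::real)"
  by (simp add: add_nonneg_eq_0_iff)

lemma continuous_mixed_derivative:
  "continuous_on UNIV (\<lambda>(u, s). - (2 * exp u * sinh s / ((exp u)\<^sup>2 + (sinh s)\<^sup>2)) :: real)"
  unfolding split_beta by (intro continuous_intros) (auto simp: exp_sinh_squares_nonzero)

lemma continuous_sector_angle_ds:
  "continuous_on UNIV (\<lambda>(u, s). 2 * exp u * cosh s / ((exp u)\<^sup>2 + (sinh s)\<^sup>2) :: real)"
  unfolding split_beta by (intro continuous_intros) (auto simp: exp_sinh_squares_nonzero)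

section \<open>Strict convexity\<close>

text \<open>The compared quantity is the slope of the potential along a line, and its derivative is
  the Hessian form in the direction \<open>(a, b)\<close>. Formulated through the gradient only, so
  that uniqueness needs no potential.\<close>

lemma curvature_angle_line_mono:
  fixes a b u s t t' :: real
  assumes "a \<noteq> 0 \<or> b \<noteq> 0" "t < t'"
  shows "arc_curvature (u + t * a) (s + t * b) * a + sector_angle (u + t * a) (s + t * b) * b <
    arc_curvature (u + t' * a) (s + t' * b) * a + sector_angle (u + t' * a) (s + t' * b) * b"
proof (rule DERIV_pos_imp_increasing[OF assms(2)])
  fix r :: real
  define x y where "x = u + r * a" and "y = s + r * b"
  define m where "m = - (2 * exp x * sinh y / ((exp x)\<^sup>2 + (sinh y)\<^sup>2))"
  define n where "n = 2 * exp x * cosh y / ((exp x)\<^sup>2 + (sinh y)\<^sup>2)"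
  have L: "((\<lambda>t. arc_curvature (u + t * a) (s + t * b)) has_real_derivative arc_curvature_du x y * a + m * b) (at r)"
    unfolding x_def y_def m_def
    by (rule line_derivative[OF arc_curvature_deriv_u arc_curvature_deriv_s continuous_mixed_derivative])
  have A: "((\<lambda>t. sector_angle (u + t * a) (s + t * b)) has_real_derivative m * a + n * b) (at r)"
    unfolding x_def y_def m_def n_def
    by (rule line_derivative[OF sector_angle_deriv_u sector_angle_deriv_s continuous_sector_angle_ds])
  have "((\<lambda>t. arc_curvature (u + t * a) (s + t * b) * a + sector_angle (u + t * a) (s + t * b) * b)
      has_real_derivative (arc_curvature_du x y * a + m * b) * a + (m * a + n * b) * b) (at r)"
    by (intro DERIV_add DERIV_cmult_right L A)
  moreover have "(arc_curvature_du x y * a + m * b) * a + (m * a + n * b) * b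
      = arc_curvature_du x y * a\<^sup>2 + 2 * m * a * b + n * b\<^sup>2"
    by (simp add: algebra_simps power2_eq_square)
  moreover have "0 < arc_curvature_du x y * a\<^sup>2 + 2 * m * a * b + n * b\<^sup>2"
    unfolding m_def n_def by (rule arc_curvature_hessian_pos[OF assms(1)])
  ultimately show "\<exists>D. ((\<lambda>t. arc_curvature (u + t * a) (s + t * b) * a + sector_angle (u + t * a) (s + t * b) * b)
      has_real_derivative D) (at r) \<and> 0 < D"
    by (intro exI conjI) auto
qed

lemma curvature_angle_strict_mono:
  assumes "u \<noteq> u' \<or> s \<noteq> s'"
  shows "0 < (arc_curvature u' s' - arc_curvature u s) * (u' - u) + (sector_angle u' s' - sector_angle u s) * (s' - s)"
  using curvature_angle_line_mono[of "u' - u" "s' - s" 0 1 u s] assms by (auto simp: algebra_simps)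

lemma packing_potential:
  obtains \<Phi> where "\<And>u s. ((\<lambda>u. \<Phi> u s) has_real_derivative arc_curvature u s) (at u)"
    "\<And>u s. ((\<lambda>s. \<Phi> u s) has_real_derivative sector_angle u s) (at s)"
  by (rule closed_form_potential[OF arc_curvature_deriv_u arc_curvature_deriv_s sector_angle_deriv_u sector_angle_deriv_s
        continuous_arc_curvature continuous_sector_angle continuous_arc_curvature_du continuous_mixed_derivative
        continuous_sector_angle_ds]) blast

text \<open>Mean value theorem on the segment between the two points: the intermediate slope exceeds
  the initial one.\<close>

lemma potential_supporting_plane:
  assumes u: "\<And>u s. ((\<lambda>u. \<Phi> u s) has_real_derivative arc_curvature u s) (at u)"
    and s: "\<And>u s. ((\<lambda>s. \<Phi> u s) has_real_derivative sector_angle u s) (at s)"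
  shows "\<Phi> u0 s0 + arc_curvature u0 s0 * (u - u0) + sector_angle u0 s0 * (s - s0) \<le> \<Phi> u s"
proof (cases "u = u0 \<and> s = s0")
  case True
  then show ?thesis by simp
next
  case False
  define a b where "a = u - u0" and "b = s - s0"
  define G where "G = (\<lambda>t. arc_curvature (u0 + t * a) (s0 + t * b) * a + sector_angle (u0 + t * a) (s0 + t * b) * b)"
  have "((\<lambda>t. \<Phi> (u0 + t * a) (s0 + t * b)) has_real_derivative G t) (at t)" for t
    unfolding G_def by (rule line_derivative[OF u s continuous_sector_angle])
  then obtain z where z: "0 < z" "\<Phi> (u0 + 1 * a) (s0 + 1 * b) - \<Phi> (u0 + 0 * a) (s0 + 0 * b) = (1 - 0) * G z"
    using MVT2[of 0 1 "\<lambda>t. \<Phi> (u0 + t * a) (s0 + t * b)" G] by auto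
  have "G 0 < G z"
    unfolding G_def by (rule curvature_angle_line_mono) (use False z in \<open>auto simp: a_def b_def\<close>)
  then show ?thesis using z by (simp add: G_def a_def b_def)
qed

section \<open>Bounds for a single arc\<close>

lemma arc_curvature_pos: "0 < arc_curvature u s"
proof -
  have "integral {0..1} (\<lambda>t::real. 0::real) < arc_curvature u s"
    unfolding arc_curvature_def
  proof (rule integral_less_real)
    show "continuous_on {0..1} (\<lambda>t. 2 * exp u * cosh s / ((cosh s)\<^sup>2 + ((exp u)\<^sup>2 - 1) * t\<^sup>2))"
      by (intro continuous_intros) (auto simp: cosh_denominator_nonzero)
    fix t :: real assume "t \<in> {0<..<1}"
    then show "0 < 2 * exp u * cosh s / ((cosh s)\<^sup>2 + ((exp u)\<^sup>2 - 1) * t\<^sup>2)"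
      using cosh_denominator_pos[of t s u] by simp
  qed auto
  then show ?thesis by simp
qed

lemma sector_angle_bounds:
  assumes "0 < s"
  shows "0 < sector_angle u s" "sector_angle u s < pi"
  using assms arctan_ubound[of "sinh s / exp u"] by (auto simp: sector_angle_def)

text \<open>Gauss-Bonnet: the defect \<open>pi - sector_angle u s - arc_curvature u s\<close> is the area of the part of
  the sector cut off by the arc.\<close>

lemma arc_curvature_less:
  assumes s: "0 < s"
  shows "arc_curvature u s < pi - sector_angle u s"
proof -
  define x k where "x = exp u" and "k = cosh s"
  define q where "q = (\<lambda>t. sqrt (k\<^sup>2 - t\<^sup>2))"
  define l where "l = (\<lambda>t. 2 * x * k / (k\<^sup>2 + (x\<^sup>2 - 1) * t\<^sup>2))"
  have x: "0 < x" and k: "1 < k" using s cosh_real_ge_1[of s] by (auto simp: x_def k_def less_le)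
  have q: "0 < q t" "(q t)\<^sup>2 = k\<^sup>2 - t\<^sup>2" if "t \<in> {0..1}" for t
  proof -
    have "t\<^sup>2 < k\<^sup>2" using that k by (intro power_strict_mono) auto
    then show "0 < q t" "(q t)\<^sup>2 = k\<^sup>2 - t\<^sup>2" by (auto simp: q_def)
  qed
  \<comment> \<open>The factor \<open>k / q t\<close> exceeds 1 inside the interval and makes the
    integrand the derivative of \<open>2 * arctan (x * (t / q t))\<close>, uniformly for all three
    types of curves. As \<open>q 1 = sinh s\<close>, the larger integral is exactly
    \<open>pi - sector_angle u s\<close>.\<close>
  have "integral {0..1} l < integral {0..1} (\<lambda>t. l t * (k / q t))"
  proof (rule integral_less_real)
    show cl: "continuous_on {0..1} l"
      unfolding l_def x_def k_def by (intro continuous_intros) (auto simp: cosh_denominator_nonzero)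
    have "continuous_on {0..1} q" unfolding q_def by (intro continuous_intros)
    then show "continuous_on {0..1} (\<lambda>t. l t * (k / q t))"
      using q by (intro continuous_intros cl) force+
    fix t :: real assume t: "t \<in> {0<..<1}"
    have "0 < l t"
      unfolding l_def using arc_denominator_pos[of k x t] t x k by simp
    moreover have "1 < k / q t"
    proof -
      have "(q t)\<^sup>2 < k\<^sup>2" using q(2)[of t] t by simp
      then have "q t < k" using k by (meson less_le_trans less_imp_le power2_less_imp_less zero_less_one)
      then show ?thesis using q(1)[of t] t by simp
    qed
    ultimately show "l t < l t * (k / q t)"
      using mult_strict_left_mono[of 1 "k / q t" "l t"] by simp
  qed auto
  moreover have "((\<lambda>t. l t * (k / q t)) has_integral (2 * arctan (x * (1 / q 1)) - 2 * arctan (x * (0 / q 0)))) {0..1}"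
  proof (rule fundamental_theorem_of_calculus)
    fix t :: real assume t: "t \<in> {0..1}"
    note qt = q[OF t]
    have dq: "(q has_real_derivative - t / q t) (at t)"
      unfolding q_def using qt by (auto intro!: derivative_eq_intros simp: q_def field_simps)
    have "((\<lambda>t. t / q t) has_real_derivative (1 * q t - t * (- t / q t)) / (q t * q t)) (at t)"
      using qt by (intro DERIV_divide dq) auto
    moreover have "1 * q t - t * (- t / q t) = k\<^sup>2 / q t"
      using qt by (simp add: field_simps power2_eq_square)
    ultimately have "((\<lambda>t. 2 * arctan (x * (t / q t))) has_real_derivative
        2 * (inverse (1 + (x * (t / q t))\<^sup>2) * (x * (k\<^sup>2 / q t / (q t * q t))))) (at t)"
      by (intro DERIV_cmult DERIV_chain2[OF DERIV_arctan]) simp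
    moreover have "2 * (inverse (1 + (x * (t / q t))\<^sup>2) * (x * (k\<^sup>2 / q t / (q t * q t)))) = l t * (k / q t)"
    proof -
      define w n where "w = q t" and "n = k\<^sup>2 + (x\<^sup>2 - 1) * t\<^sup>2"
      have w: "0 < w" "w\<^sup>2 = k\<^sup>2 - t\<^sup>2" and n: "0 < n"
        using qt arc_denominator_pos[of k x t] t x k by (auto simp: w_def n_def)
      have "1 + (x * (t / w))\<^sup>2 = (w\<^sup>2 + x\<^sup>2 * t\<^sup>2) / w\<^sup>2"
        using w(1) by (simp add: field_simps)
      also have "w\<^sup>2 + x\<^sup>2 * t\<^sup>2 = n"
        unfolding w(2) n_def by (simp add: left_diff_distrib)
      finally show ?thesis
        unfolding l_def n_def[symmetric] w_def[symmetric] using w(1) n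
        by (simp add: power2_eq_square)
    qed
    ultimately have "((\<lambda>t. 2 * arctan (x * (t / q t))) has_real_derivative l t * (k / q t)) (at t)"
      by simp
    then show "((\<lambda>t. 2 * arctan (x * (t / q t))) has_vector_derivative l t * (k / q t)) (at t within {0..1})"
      by (simp add: has_real_derivative_iff_has_vector_derivative has_vector_derivative_at_within)
  qed simp
  moreover have "q 1 = sinh s" using s by (simp add: q_def k_def cosh_square_eq)
  moreover have "arctan (x / sinh s) = pi / 2 - arctan (sinh s / x)"
    using arctan_inverse[of "sinh s / x"] s x by simp
  ultimately show ?thesis
    by (simp add: integral_unique arc_curvature_def sector_angle_def l_def x_def k_def)
qed

text \<open>Gives slopes near \<open>(pi, 0)\<close>, since \<open>sector_angle u 0 = 0\<close>.
  Adding \<open>t\<^sup>2\<close> to the denominator decreases the integrand and turns it into the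
  derivative of \<open>2 * arctan (x * t)\<close>.\<close>

lemma arc_curvature_at_zero:
  assumes "0 \<le> u"
  shows "2 * arctan (exp u) \<le> arc_curvature u 0"
proof -
  define x where "x = exp u"
  have x: "1 \<le> x" using assms by (simp add: x_def)
  have "((\<lambda>t. 2 * (x / (1 + (x * t)\<^sup>2))) has_integral (2 * arctan (x * 1) - 2 * arctan (x * 0))) {0..1}"
  proof (rule fundamental_theorem_of_calculus)
    fix t :: real
    have "((\<lambda>t. 2 * arctan (x * t)) has_real_derivative 2 * (x / (1 + (x * t)\<^sup>2))) (at t)"
      by (auto intro!: derivative_eq_intros simp: field_simps)
    then show "((\<lambda>t. 2 * arctan (x * t)) has_vector_derivative 2 * (x / (1 + (x * t)\<^sup>2))) (at t within {0..1})"
      by (simp add: has_real_derivative_iff_has_vector_derivative has_vector_derivative_at_within)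
  qed simp
  moreover have "((\<lambda>t. 2 * x * cosh 0 / ((cosh 0)\<^sup>2 + (x\<^sup>2 - 1) * t\<^sup>2)) has_integral arc_curvature u 0) {0..1}"
    unfolding arc_curvature_def x_def
    by (intro integrable_integral integrable_continuous_interval continuous_intros)
      (auto simp: cosh_denominator_nonzero simp del: cosh_0)
  ultimately have "2 * arctan (x * 1) - 2 * arctan (x * 0) \<le> arc_curvature u 0"
  proof (rule has_integral_le)
    fix t :: real assume "t \<in> {0..1}"
    then have "0 < 1\<^sup>2 + (x\<^sup>2 - 1) * t\<^sup>2" using x by (intro arc_denominator_pos) auto
    then have "x / (1 + (x * t)\<^sup>2) \<le> x / (1\<^sup>2 + (x\<^sup>2 - 1) * t\<^sup>2)"
      using x by (intro divide_left_mono) (auto simp: left_diff_distrib power_mult_distrib add_pos_nonneg)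
    then show "2 * (x / (1 + (x * t)\<^sup>2)) \<le> 2 * x * cosh 0 / ((cosh 0)\<^sup>2 + (x\<^sup>2 - 1) * t\<^sup>2)"
      by simp
  qed
  then show ?thesis by (simp add: x_def)
qed

lemma arc_curvature_horocycle: "arc_curvature 0 s = 2 / cosh s"
  by (simp add: arc_curvature_def power2_eq_square)

section \<open>Agreement with the geometric arc length and central angle\<close>

text \<open>\<open>arc_length_primitive\<close> accepts any odd primitive, so an abstract
  antiderivative does instead of the three explicit ones. Both sides are then the same integral,
  related by the substitution of \<open>t / k0\<close>.\<close>

lemma arc_curvature_eq_arc_length:
  assumes k: "1 < k0" and x: "0 < x"
  shows "x * arc_length k0 x = arc_curvature (ln x) (arcosh k0)"
proof -
  define g where "g = (\<lambda>u. 1 / (1 + (x\<^sup>2 - 1) * u\<^sup>2))"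
  have den: "1 + (x\<^sup>2 - 1) * u\<^sup>2 \<noteq> 0" if "-1 \<le> u" "u \<le> 1" for u
  proof -
    have "0 < 1\<^sup>2 + (x\<^sup>2 - 1) * \<bar>u\<bar>\<^sup>2" by (rule arc_denominator_pos) (use that x in auto)
    then show ?thesis by simp
  qed
  have "continuous_on {-1..1} g"
    unfolding g_def by (intro continuous_intros) (auto simp: den)
  then obtain P where P: "\<And>u. u \<in> {-1..1} \<Longrightarrow> (P has_vector_derivative g u) (at u within {-1..1})"
    by (rule antiderivative_continuous) blast
  have dP: "(P has_real_derivative g u) (at u)" if "\<bar>u\<bar> < 1" for u
  proof -
    have u: "-1 < u" "u < 1" using that by auto
    then have "at u within {-1..1} = at u" by (intro at_within_interior) simp
    then show ?thesis
      using P[of u] u by (simp add: has_real_derivative_iff_has_vector_derivative)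
  qed
  \<comment> \<open>Antisymmetrising preserves the derivative because \<open>g\<close> is even, and
    supplies the required oddness.\<close>
  define Q where "Q = (\<lambda>u. (P u - P (- u)) / 2)"
  have Q_odd: "Q (- u) = - Q u" for u by (simp add: Q_def diff_divide_distrib)
  have dQ: "(Q has_real_derivative g u) (at u)" if "\<bar>u\<bar> < 1" for u
  proof -
    have ge: "g (- u) = g u" by (simp add: g_def)
    have P': "((\<lambda>u. P (- u)) has_real_derivative g (- u) * - 1) (at u)"
      by (rule DERIV_chain2[OF dP]) (use that in \<open>auto intro!: derivative_eq_intros\<close>)
    show ?thesis
      using DERIV_cdivide[OF DERIV_diff[OF dP[OF that] P'], of 2] by (simp add: Q_def ge)
  qed
  have k1: "\<bar>u\<bar> < 1" if "\<bar>u\<bar> \<le> 1 / k0" for u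
  proof -
    have "1 / k0 < 1" using k by simp
    then show ?thesis using that by linarith
  qed
  have "arc_length k0 x = 2 * Q (1 / k0)"
    by (rule arc_length_primitive[OF k x]) (use dQ k1 Q_odd in \<open>auto simp: g_def\<close>)
  moreover have "((\<lambda>t. 2 * x * k0 / (k0\<^sup>2 + (x\<^sup>2 - 1) * t\<^sup>2)) has_integral 2 * x * Q (1 / k0) - 2 * x * Q (0 / k0)) {0..1}"
  proof (rule fundamental_theorem_of_calculus)
    fix t :: real assume t: "t \<in> {0..1}"
    then have "\<bar>t / k0\<bar> < 1" using k by (intro k1) (simp add: divide_right_mono)
    then have "((\<lambda>t. 2 * x * Q (t / k0)) has_real_derivative 2 * x * (g (t / k0) * (1 / k0))) (at t)"
      by (intro DERIV_cmult DERIV_chain2[OF dQ DERIV_cdivide[OF DERIV_ident]])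
    moreover have "2 * x * (g (t / k0) * (1 / k0)) = 2 * x * k0 / (k0\<^sup>2 + (x\<^sup>2 - 1) * t\<^sup>2)"
    proof -
      have "1 + (x\<^sup>2 - 1) * (t / k0)\<^sup>2 = (k0\<^sup>2 + (x\<^sup>2 - 1) * t\<^sup>2) / k0\<^sup>2"
        using k by (simp add: field_simps)
      then show ?thesis unfolding g_def using k by (simp add: power2_eq_square)
    qed
    ultimately show "((\<lambda>t. 2 * x * Q (t / k0)) has_vector_derivative 2 * x * k0 / (k0\<^sup>2 + (x\<^sup>2 - 1) * t\<^sup>2)) (at t within {0..1})"
      by (simp add: has_real_derivative_iff_has_vector_derivative has_vector_derivative_at_within)
  qed simp
  then have "integral {0..1} (\<lambda>t. 2 * x * k0 / (k0\<^sup>2 + (x\<^sup>2 - 1) * t\<^sup>2)) = 2 * x * Q (1 / k0)"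
    by (simp add: integral_unique Q_def)
  ultimately show ?thesis
    using k x by (simp add: arc_curvature_def)
qed

lemma sector_angle_eq_central_angle:
  assumes "1 < k0" "0 < x"
  shows "central_angle k0 x = sector_angle (ln x) (arcosh k0)"
  using assms by (simp add: central_angle_def sector_angle_def sinh_arcosh_real)

section \<open>Coercivity and existence\<close>

text \<open>The supporting planes have slopes close to \<open>(pi, 0)\<close> and \<open>(0, \<plusminus>pi)\<close>.\<close>

lemma potential_lower_bound:
  assumes u: "\<And>u s. ((\<lambda>u. \<Phi> u s) has_real_derivative arc_curvature u s) (at u)"
    and s: "\<And>u s. ((\<lambda>s. \<Phi> u s) has_real_derivative sector_angle u s) (at s)"
    and e: "0 < \<epsilon>"
  obtains C where "\<And>u s. (pi - \<epsilon>) * max (max 0 u) \<bar>s\<bar> - \<epsilon> * max 0 (- u) - C \<le> \<Phi> u s"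
proof -
  note plane = potential_supporting_plane[OF u s]
  have "((\<lambda>u. arctan (exp u)) \<longlongrightarrow> pi / 2) at_top"
    using filterlim_compose[OF tendsto_arctan_at_top exp_at_top] .
  then have "\<forall>\<^sub>F u in at_top. pi / 2 - \<epsilon> / 2 < arctan (exp u)"
    using e by (intro order_tendstoD(1)) auto
  then have "\<forall>\<^sub>F u in at_top. pi / 2 - \<epsilon> / 2 < arctan (exp u) \<and> 0 \<le> (u::real)"
    using eventually_conj eventually_ge_at_top by blast
  then obtain u0 :: real where u0: "pi / 2 - \<epsilon> / 2 < arctan (exp u0)" "0 \<le> u0"
    using eventually_happens' trivial_limit_at_top_linorder by blast
  define p0 where "p0 = arc_curvature u0 0"
  have p0: "pi - \<epsilon> \<le> p0" using u0 arc_curvature_at_zero[of u0] by (simp add: p0_def)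
  have "((\<lambda>s. arctan (sinh s)) \<longlongrightarrow> pi / 2) at_top"
    using filterlim_compose[OF tendsto_arctan_at_top sinh_real_at_top] .
  then have "\<forall>\<^sub>F s in at_top. pi / 2 - \<epsilon> / 2 < arctan (sinh s)"
    using e by (intro order_tendstoD(1)) auto
  then have "\<forall>\<^sub>F s in at_top. pi / 2 - \<epsilon> / 2 < arctan (sinh s) \<and> 0 < (s::real)"
    using eventually_conj eventually_gt_at_top by blast
  then obtain s0 :: real where s0: "pi / 2 - \<epsilon> / 2 < arctan (sinh s0)" "0 < s0"
    using eventually_happens' trivial_limit_at_top_linorder by blast
  define p1 q1 where "p1 = arc_curvature 0 s0" and "q1 = sector_angle 0 s0"
  have q1: "pi - \<epsilon> \<le> q1" using s0 by (simp add: q1_def sector_angle_def)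
  \<comment> \<open>Gauss-Bonnet makes the \<open>u\<close>-slope small where the angle is nearly
    \<open>pi\<close>: \<open>p1 < pi - q1 \<le> \<epsilon>\<close>.\<close>
  have p1: "0 < p1" "p1 \<le> \<epsilon>"
    using arc_curvature_pos[of 0 s0] arc_curvature_less[OF s0(2), of 0] q1 by (auto simp: p1_def q1_def)
  \<comment> \<open>The parity in \<open>s\<close> yields the third plane by reflection.\<close>
  have m: "arc_curvature 0 (- s0) = p1" "sector_angle 0 (- s0) = - q1"
    by (simp_all add: p1_def q1_def arc_curvature_def sector_angle_def arctan_minus)
  define C0 where "C0 = p0 * u0 - \<Phi> u0 0"
  define C1 where "C1 = q1 * s0 - \<Phi> 0 s0"
  define C2 where "C2 = q1 * s0 - \<Phi> 0 (- s0)"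
  show ?thesis
  proof
    fix u s
    have b0: "p0 * u - C0 \<le> \<Phi> u s"
      using plane[of u0 0 u s] by (simp add: C0_def p0_def sector_angle_def algebra_simps)
    have b1: "p1 * u + q1 * s - C1 \<le> \<Phi> u s"
      using plane[of 0 s0 u s] by (simp add: C1_def p1_def q1_def algebra_simps)
    have b2: "p1 * u - q1 * s - C2 \<le> \<Phi> u s"
      using plane[of 0 "-s0" u s] by (simp add: C2_def m algebra_simps)
    \<comment> \<open>For negative \<open>u\<close> the two planes at
      \<open>(0, \<plusminus>s0)\<close> descend, but with slope at most \<epsilon>; this is the
      origin of the loss term in the bound.\<close>
    have n: "- (\<epsilon> * max 0 (- u)) \<le> p1 * u"
    proof (cases "0 \<le> u")
      case True
      then show ?thesis using p1 e by (simp add: max_def)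
    next
      case False
      then have "\<epsilon> * u \<le> p1 * u" using p1 by (intro mult_right_mono_neg) auto
      then show ?thesis using False by (simp add: max_def)
    qed
    have n0: "0 \<le> \<epsilon> * max 0 (- u)" using e by simp
    show "(pi - \<epsilon>) * max (max 0 u) \<bar>s\<bar> - \<epsilon> * max 0 (- u) - (\<bar>C0\<bar> + \<bar>C1\<bar> + \<bar>C2\<bar>) \<le> \<Phi> u s"
    proof (cases "\<bar>s\<bar> < u")
      case True
      then have m: "max (max 0 u) \<bar>s\<bar> = u" and "0 \<le> u" by auto
      have "(pi - \<epsilon>) * u \<le> p0 * u" using p0 \<open>0 \<le> u\<close> by (rule mult_right_mono)
      then show ?thesis unfolding m using b0 n0 by linarith
    next
      case False
      then have m: "max (max 0 u) \<bar>s\<bar> = \<bar>s\<bar>" by auto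
      have "(pi - \<epsilon>) * \<bar>s\<bar> \<le> q1 * \<bar>s\<bar>" using q1 by (intro mult_right_mono) auto
      moreover have "p1 * u + q1 * \<bar>s\<bar> - (\<bar>C1\<bar> + \<bar>C2\<bar>) \<le> \<Phi> u s"
        using b1 b2 by (cases "0 \<le> s") auto
      ultimately show ?thesis unfolding m using n by linarith
    qed
  qed
qed

section \<open>The recession function of the energy\<close>

lemma layer_cake:
  fixes x M :: real
  assumes "0 \<le> x" "x \<le> M"
  shows "((\<lambda>t. of_bool (t < x)) has_integral x) {0..M}"
proof -
  have "((\<lambda>t::real. 1::real) has_integral x) {0..x}"
    using has_integral_const_real[of "1::real" 0 x] assms by simp
  then have "((\<lambda>t. of_bool (t < x)) has_integral x) {0..x}"
    by (rule has_integral_spike_finite[of "{x}", rotated 2]) auto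
  moreover have "((\<lambda>t. of_bool (t < x)) has_integral (0::real)) {x..M}"
    by (rule has_integral_eq[OF _ has_integral_0]) auto
  ultimately show ?thesis
    using has_integral_combine[OF assms] by fastforce
qed

text \<open>The bounded expression is the recession function of the energy. On indicators of superlevel sets
  it is controlled by the admissibility inequalities, and the general case follows by integrating over
  the levels.\<close>

lemma recession_positive:
  fixes V :: "'a set" and F :: "'b set" and nb :: "'b \<Rightarrow> 'a set" and L :: "'a \<Rightarrow> real" and \<alpha> :: "'b \<Rightarrow> real"
  assumes fin: "finite V" "finite F" and nb: "\<forall>f\<in>F. nb f \<subseteq> V"
    and \<alpha>: "\<forall>f\<in>F. \<alpha> f < pi * card (nb f)"
    and adm: "\<forall>W. W \<subseteq> V \<longrightarrow> W \<noteq> {} \<longrightarrow> (\<Sum>w\<in>W. L w) <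
      (\<Sum>f | f \<in> F \<and> W \<inter> nb f \<noteq> {}. min (pi * card (W \<inter> nb f)) (pi * card (nb f) - \<alpha> f))"
  obtains \<delta> where "0 < \<delta>" "\<forall>(a :: 'a \<Rightarrow> real) (b :: 'b \<Rightarrow> real). (\<forall>v\<in>V. 0 \<le> a v) \<longrightarrow> (\<forall>f\<in>F. 0 \<le> b f) \<longrightarrow>
    (\<forall>m \<in> insert 0 (a ` V \<union> b ` F).
    \<delta> * m \<le> (\<Sum>f\<in>F. \<Sum>v\<in>nb f. pi * max (a v) (b f)) - (\<Sum>v\<in>V. L v * a v) - (\<Sum>f\<in>F. \<alpha> f * b f))"
proof -
  note nb = nb[rule_format] and \<alpha> = \<alpha>[rule_format] and adm = adm[rule_format]
  define h where "h = (\<lambda>(W, B). (\<Sum>f\<in>F. \<Sum>v\<in>nb f. pi * of_bool (v \<in> W \<or> f \<in> B))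
    - (\<Sum>v\<in>V. L v * of_bool (v \<in> W)) - (\<Sum>f\<in>F. \<alpha> f * of_bool (f \<in> B)))"
  have finnb: "finite (nb f)" if "f \<in> F" for f using nb[OF that] fin finite_subset by blast
  have h_pos: "0 < h (W, B)" if WB: "W \<subseteq> V" "B \<subseteq> F" "W \<noteq> {} \<or> B \<noteq> {}" for W B
  proof -
    \<comment> \<open>\<open>c f\<close> is the net contribution of a face once it is known whether
      \<open>f \<in> B\<close>. In both cases it is at least the minimum in the admissibility
      condition, so one inequality per \<open>W\<close> handles every \<open>B\<close>.\<close>
    define c where "c = (\<lambda>f. if f \<in> B then pi * card (nb f) - \<alpha> f else pi * card (W \<inter> nb f))"
    have "(\<Sum>v\<in>nb f. pi * of_bool (v \<in> W \<or> f \<in> B)) - \<alpha> f * of_bool (f \<in> B) = c f" if "f \<in> F" for f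
    proof (cases "f \<in> B")
      case False
      have "(\<Sum>v\<in>nb f. pi * of_bool (v \<in> W)) = (\<Sum>v\<in>nb f. if v \<in> W then pi else 0)"
        by (intro sum.cong) auto
      also have "\<dots> = (\<Sum>v\<in>W \<inter> nb f. pi)"
        using finnb[OF that] by (simp add: sum.If_cases Int_commute)
      finally show ?thesis using False by (simp add: c_def mult.commute)
    qed (simp add: c_def mult.commute)
    then have "(\<Sum>f\<in>F. (\<Sum>v\<in>nb f. pi * of_bool (v \<in> W \<or> f \<in> B)) - \<alpha> f * of_bool (f \<in> B)) = (\<Sum>f\<in>F. c f)"
      by (intro sum.cong) auto
    moreover have "(\<Sum>v\<in>V. L v * of_bool (v \<in> W)) = (\<Sum>w\<in>W. L w)"
    proof -
      have "(\<Sum>v\<in>V. L v * of_bool (v \<in> W)) = (\<Sum>v\<in>V. if v \<in> W then L v else 0)"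
        by (intro sum.cong) auto
      also have "\<dots> = (\<Sum>v\<in>V \<inter> W. L v)" using fin by (simp add: sum.If_cases)
      finally show ?thesis using WB by (simp add: Int_absorb1)
    qed
    ultimately have h: "h (W, B) = (\<Sum>f\<in>F. c f) - (\<Sum>w\<in>W. L w)"
      by (simp add: h_def sum_subtractf)
    have c0: "0 \<le> c f" if "f \<in> F" for f using \<alpha>[OF that] by (simp add: c_def)
    show ?thesis
    proof (cases "W = {}")
      case True
      \<comment> \<open>Without vertices the admissibility condition is silent; a face of
        \<open>B\<close> contributes a positive amount because its cone angle is below
        \<open>pi * card (nb f)\<close>.\<close>
      then obtain f where f: "f \<in> B" "f \<in> F" using WB by auto
      then have "0 < (\<Sum>f\<in>F. c f)"
        using \<alpha>[OF f(2)] by (intro sum_pos2[OF fin(2) f(2)] c0) (simp add: c_def)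
      then show ?thesis using h True by simp
    next
      case False
      have "(\<Sum>w\<in>W. L w) < (\<Sum>f | f \<in> F \<and> W \<inter> nb f \<noteq> {}. min (pi * card (W \<inter> nb f)) (pi * card (nb f) - \<alpha> f))"
        using adm WB False by blast
      also have "\<dots> \<le> (\<Sum>f | f \<in> F \<and> W \<inter> nb f \<noteq> {}. c f)"
        by (intro sum_mono) (simp add: c_def)
      also have "\<dots> \<le> (\<Sum>f\<in>F. c f)"
        using fin c0 by (intro sum_mono2) auto
      finally show ?thesis using h by simp
    qed
  qed
  \<comment> \<open>Finitely many pairs of level sets give a uniform gap. The extra element 1 keeps
    the minimum meaningful when \<open>V\<close> and \<open>F\<close> are both empty.\<close>
  define D where "D = insert 1 (h ` (Pow V \<times> Pow F - {({}, {})}))"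
  have "finite D" using fin by (simp add: D_def)
  define \<delta> where "\<delta> = Min D"
  have "0 < \<delta>"
    unfolding \<delta>_def using \<open>finite D\<close> by (subst Min_gr_iff) (auto simp: D_def intro!: h_pos)
  have h_ge: "\<delta> \<le> h (W, B)" if "W \<subseteq> V" "B \<subseteq> F" "W \<noteq> {} \<or> B \<noteq> {}" for W B
    unfolding \<delta>_def using that \<open>finite D\<close> by (intro Min_le) (auto simp: D_def)
  show ?thesis
  proof (rule that[OF \<open>0 < \<delta>\<close>], intro allI impI ballI)
    fix a :: "'a \<Rightarrow> real" and b :: "'b \<Rightarrow> real" and m
    assume ab: "\<forall>v\<in>V. 0 \<le> a v" "\<forall>f\<in>F. 0 \<le> b f"
      and m: "m \<in> insert 0 (a ` V \<union> b ` F)"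
    note a = ab(1)[rule_format] and b = ab(2)[rule_format]
    define M where "M = Max (insert 0 (a ` V \<union> b ` F))"
    have M: "x \<le> M" if "x \<in> insert 0 (a ` V \<union> b ` F)" for x
      unfolding M_def using fin that by (intro Max_ge) auto
    \<comment> \<open>A maximum exceeds \<open>t\<close> exactly if one of its arguments does, so at
      each level the integrand of \<open>H\<close> is \<open>h\<close> of the two superlevel
      sets.\<close>
    define Wt Bt where "Wt = (\<lambda>t. {v\<in>V. t < a v})" and "Bt = (\<lambda>t. {f\<in>F. t < b f})"
    define H where "H = (\<Sum>f\<in>F. \<Sum>v\<in>nb f. pi * max (a v) (b f)) - (\<Sum>v\<in>V. L v * a v) - (\<Sum>f\<in>F. \<alpha> f * b f)"
    have "((\<lambda>t. (\<Sum>f\<in>F. \<Sum>v\<in>nb f. pi * of_bool (t < max (a v) (b f)))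
        - (\<Sum>v\<in>V. L v * of_bool (t < a v)) - (\<Sum>f\<in>F. \<alpha> f * of_bool (t < b f))) has_integral H) {0..M}"
      unfolding H_def
    proof (intro has_integral_diff has_integral_sum has_integral_mult_right layer_cake fin)
      fix f v assume "f \<in> F" "v \<in> nb f"
      then show "0 \<le> max (a v) (b f)" "max (a v) (b f) \<le> M"
        using nb[of f] a[of v] M[of "a v"] M[of "b f"] by auto
    qed (use a b M finnb in auto)
    moreover have "h (Wt t, Bt t) = (\<Sum>f\<in>F. \<Sum>v\<in>nb f. pi * of_bool (t < max (a v) (b f)))
        - (\<Sum>v\<in>V. L v * of_bool (t < a v)) - (\<Sum>f\<in>F. \<alpha> f * of_bool (t < b f))" for t
    proof -
      have "(\<Sum>f\<in>F. \<Sum>v\<in>nb f. pi * of_bool (v \<in> Wt t \<or> f \<in> Bt t)) =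
          (\<Sum>f\<in>F. \<Sum>v\<in>nb f. pi * of_bool (t < max (a v) (b f)))"
        by (intro sum.cong refl) (use nb in \<open>auto simp: Wt_def Bt_def less_max_iff_disj\<close>)
      moreover have "(\<Sum>v\<in>V. L v * of_bool (v \<in> Wt t)) = (\<Sum>v\<in>V. L v * of_bool (t < a v))"
        by (intro sum.cong refl) (auto simp: Wt_def)
      moreover have "(\<Sum>f\<in>F. \<alpha> f * of_bool (f \<in> Bt t)) = (\<Sum>f\<in>F. \<alpha> f * of_bool (t < b f))"
        by (intro sum.cong refl) (auto simp: Bt_def)
      ultimately show ?thesis by (simp add: h_def)
    qed
    ultimately have H: "((\<lambda>t. h (Wt t, Bt t)) has_integral H) {0..M}" by simp
    have m0: "0 \<le> m" using m a b by auto
    have "((\<lambda>t. \<delta> * of_bool (t < m)) has_integral \<delta> * m) {0..M}"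
      by (intro has_integral_mult_right layer_cake m0 M m)
    from this H have "\<delta> * m \<le> H"
    proof (rule has_integral_le)
      fix t :: real assume t: "t \<in> {0..M}"
      show "\<delta> * of_bool (t < m) \<le> h (Wt t, Bt t)"
      proof (cases "Wt t \<noteq> {} \<or> Bt t \<noteq> {}")
        case True
        then have "\<delta> \<le> h (Wt t, Bt t)" by (intro h_ge) (auto simp: Wt_def Bt_def)
        then show ?thesis using \<open>0 < \<delta>\<close> by (cases "t < m") auto
      next
        case False
        \<comment> \<open>No value lies above \<open>t\<close>, and \<open>m\<close> is 0 or one of
          the values. Here \<open>h\<close> is 0 rather than at least \<delta>, matching the
          vanishing indicator.\<close>
        then have "\<not> t < m" using m t by (auto simp: Wt_def Bt_def)
        then show ?thesis using False by (simp add: h_def)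
      qed
    qed
    then show "\<delta> * m \<le> (\<Sum>f\<in>F. \<Sum>v\<in>nb f. pi * max (a v) (b f)) - (\<Sum>v\<in>V. L v * a v) - (\<Sum>f\<in>F. \<alpha> f * b f)"
      by (simp add: H_def)
  qed
qed

text \<open>The recession function controls the positive parts of \<open>x\<close> and the absolute
  values of \<open>y\<close>; the linear term with \<open>L v > 0\<close> controls the negative
  parts of \<open>x\<close>. The error of the asymptotic bound on the potential is absorbed by half
  of this gain.\<close>

lemma energy_coercive:
  fixes V :: "'a set" and F :: "'b set" and nb :: "'b \<Rightarrow> 'a set" and L :: "'a \<Rightarrow> real" and \<alpha> :: "'b \<Rightarrow> real"
  assumes u: "\<And>u s. ((\<lambda>u. \<Phi> u s) has_real_derivative arc_curvature u s) (at u)"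
    and s: "\<And>u s. ((\<lambda>s. \<Phi> u s) has_real_derivative sector_angle u s) (at s)"
    and fin: "finite V" "finite F" and nb: "\<forall>f\<in>F. nb f \<subseteq> V"
    and Lpos: "\<forall>v\<in>V. 0 < L v"
    and \<alpha>: "\<forall>f\<in>F. 0 < \<alpha> f" "\<forall>f\<in>F. \<alpha> f < pi * card (nb f)"
    and adm: "\<forall>W. W \<subseteq> V \<longrightarrow> W \<noteq> {} \<longrightarrow> (\<Sum>w\<in>W. L w) <
      (\<Sum>f | f \<in> F \<and> W \<inter> nb f \<noteq> {}. min (pi * card (W \<inter> nb f)) (pi * card (nb f) - \<alpha> f))"
  obtains R where "\<forall>x y. (\<Sum>f\<in>F. \<Sum>v\<in>nb f. \<Phi> (x v) (y f)) - (\<Sum>v\<in>V. L v * x v) - (\<Sum>f\<in>F. \<alpha> f * y f) \<le> B \<longrightarrow>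
    (\<forall>v\<in>V. \<bar>x v\<bar> \<le> R) \<and> (\<forall>f\<in>F. \<bar>y f\<bar> \<le> R)"
proof -
  obtain \<delta>0 where \<delta>0: "0 < \<delta>0" and bound: "\<forall>(a :: 'a \<Rightarrow> real) (b :: 'b \<Rightarrow> real).
    (\<forall>v\<in>V. 0 \<le> a v) \<longrightarrow> (\<forall>f\<in>F. 0 \<le> b f) \<longrightarrow> (\<forall>m \<in> insert 0 (a ` V \<union> b ` F).
    \<delta>0 * m \<le> (\<Sum>f\<in>F. \<Sum>v\<in>nb f. pi * max (a v) (b f)) - (\<Sum>v\<in>V. L v * a v) - (\<Sum>f\<in>F. \<alpha> f * b f))"
    using that by (rule recession_positive[where V = V and F = F and nb = nb and L = L and \<alpha> = \<alpha>, OF fin nb \<alpha>(2) adm])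
  note nb = nb[rule_format] and Lpos = Lpos[rule_format] and \<alpha> = \<alpha>[rule_format]
  define \<delta> where "\<delta> = Min (insert \<delta>0 (L ` V))"
  have \<delta>: "0 < \<delta>" "\<delta> \<le> \<delta>0" and \<delta>L: "\<And>v. v \<in> V \<Longrightarrow> \<delta> \<le> L v"
    unfolding \<delta>_def using fin \<delta>0 Lpos by auto
  define K where "K = (\<Sum>f\<in>F. real (card (nb f)))"
  have K: "0 \<le> K" by (simp add: K_def sum_nonneg)
  \<comment> \<open>Each of the \<open>K\<close> incidences of a vertex with a face costs at most
    \<open>\<epsilon> * (m + r)\<close> plus a constant. This choice keeps the total variable loss
    below \<open>\<delta> / 2 * (m + r)\<close>; the summand 1 covers \<open>K = 0\<close>.\<close>
  define \<epsilon> where "\<epsilon> = \<delta> / (2 * (K + 1))"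
  have \<epsilon>: "0 < \<epsilon>" using \<delta> K by (simp add: \<epsilon>_def)
  have \<epsilon>K: "\<epsilon> * K \<le> \<delta> / 2" using \<delta> K by (simp add: \<epsilon>_def field_simps)
  obtain C where C: "\<And>u s. (pi - \<epsilon>) * max (max 0 u) \<bar>s\<bar> - \<epsilon> * max 0 (- u) - C \<le> \<Phi> u s"
    using that by (rule potential_lower_bound[OF u s \<epsilon>])
  show ?thesis
  proof (rule that, intro allI impI)
    fix x y
    define E where "E = (\<Sum>f\<in>F. \<Sum>v\<in>nb f. \<Phi> (x v) (y f)) - (\<Sum>v\<in>V. L v * x v) - (\<Sum>f\<in>F. \<alpha> f * y f)"
    assume "(\<Sum>f\<in>F. \<Sum>v\<in>nb f. \<Phi> (x v) (y f)) - (\<Sum>v\<in>V. L v * x v) - (\<Sum>f\<in>F. \<alpha> f * y f) \<le> B"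
    then have EB: "E \<le> B" by (simp add: E_def)
    define a n b where "a = (\<lambda>v. max 0 (x v))" and "n = (\<lambda>v. max 0 (- x v))" and "b = (\<lambda>f. \<bar>y f\<bar>)"
    define ms where "ms = insert 0 (a ` V \<union> b ` F)"
    define m where "m = Max ms"
    define r where "r = Max (insert 0 (n ` V))"
    have "finite ms" using fin by (simp add: ms_def)
    have m_in: "m \<in> ms" unfolding m_def by (rule Max_in) (use \<open>finite ms\<close> in \<open>auto simp: ms_def\<close>)
    have m_ge: "z \<le> m" if "z \<in> ms" for z unfolding m_def using \<open>finite ms\<close> that by (rule Max_ge)
    have r_in: "r \<in> insert 0 (n ` V)" unfolding r_def by (rule Max_in) (use fin in auto)
    have r_ge: "z \<le> r" if "z \<in> insert 0 (n ` V)" for z unfolding r_def using fin that by (intro Max_ge) auto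
    have m0: "0 \<le> m" by (rule m_ge) (simp add: ms_def)
    have r0: "0 \<le> r" by (rule r_ge) simp
    have H: "\<delta>0 * m \<le> (\<Sum>f\<in>F. \<Sum>v\<in>nb f. pi * max (a v) (b f)) - (\<Sum>v\<in>V. L v * a v) - (\<Sum>f\<in>F. \<alpha> f * b f)"
      by (rule bound[rule_format]) (use m_in in \<open>auto simp: a_def b_def ms_def\<close>)
    have N: "\<delta> * r \<le> (\<Sum>v\<in>V. L v * n v)"
    proof (cases "r = 0")
      case True
      then show ?thesis using Lpos by (auto simp: n_def less_imp_le intro!: sum_nonneg)
    next
      case False
      then obtain v where v: "v \<in> V" "r = n v" using r_in by auto
      have "\<delta> * r \<le> L v * n v" using \<delta>L[OF v(1)] r0 v(2) by (simp add: mult_right_mono)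
      also have "\<dots> \<le> (\<Sum>v\<in>V. L v * n v)"
        using v fin Lpos by (intro member_le_sum) (auto simp: n_def less_imp_le)
      finally show ?thesis .
    qed
    have "pi * max (a v) (b f) - \<epsilon> * (m + r) - C \<le> \<Phi> (x v) (y f)" if "f \<in> F" "v \<in> nb f" for f v
    proof -
      have "v \<in> V" using nb that by auto
      then have "max (a v) (b f) \<le> m" "n v \<le> r" using that by (auto intro!: m_ge r_ge simp: ms_def)
      then have "\<epsilon> * (max (a v) (b f) + n v) \<le> \<epsilon> * (m + r)"
        using \<epsilon> by (intro mult_left_mono add_mono) auto
      moreover have "pi * max (a v) (b f) - \<epsilon> * (max (a v) (b f) + n v) - C \<le> \<Phi> (x v) (y f)"
        using C[of "x v" "y f"] unfolding a_def b_def n_def by (simp only: left_diff_distrib distrib_left)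
      ultimately show ?thesis by linarith
    qed
    then have "(\<Sum>f\<in>F. \<Sum>v\<in>nb f. pi * max (a v) (b f) - \<epsilon> * (m + r) - C) \<le> (\<Sum>f\<in>F. \<Sum>v\<in>nb f. \<Phi> (x v) (y f))"
      by (intro sum_mono) auto
    moreover have "(\<Sum>f\<in>F. \<Sum>v\<in>nb f. pi * max (a v) (b f) - \<epsilon> * (m + r) - C) =
        (\<Sum>f\<in>F. \<Sum>v\<in>nb f. pi * max (a v) (b f)) - K * (\<epsilon> * (m + r)) - K * C"
      by (simp add: sum_subtractf K_def sum_distrib_right)
    moreover have "(\<Sum>v\<in>V. L v * x v) = (\<Sum>v\<in>V. L v * a v) - (\<Sum>v\<in>V. L v * n v)"
      unfolding sum_subtractf[symmetric] right_diff_distrib[symmetric]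
      by (intro sum.cong) (auto simp: a_def n_def)
    \<comment> \<open>The bound on the potential sees only \<open>\<bar>y f\<bar>\<close>. With
      positive cone angles, passing to absolute values can only decrease the lower bound for the
      energy.\<close>
    moreover have "(\<Sum>f\<in>F. \<alpha> f * y f) \<le> (\<Sum>f\<in>F. \<alpha> f * b f)"
      using \<alpha>(1) by (intro sum_mono mult_left_mono) (auto simp: b_def less_imp_le)
    moreover have "K * (\<epsilon> * (m + r)) \<le> \<delta> / 2 * (m + r)"
      using mult_right_mono[OF \<epsilon>K, of "m + r"] m0 r0 by (simp add: mult_ac)
    moreover have "\<delta> * m \<le> \<delta>0 * m" using \<delta> m0 by (intro mult_right_mono) auto
    moreover have "\<delta> / 2 * (m + r) = \<delta> * m / 2 + \<delta> * r / 2" by (simp add: distrib_left)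
    ultimately have "\<delta> * m / 2 + \<delta> * r / 2 \<le> B + K * C"
      using H N EB unfolding E_def by linarith
    then have "\<delta> * (m + r) \<le> 2 * (B + K * C)" by (simp add: distrib_left)
    then have R: "m + r \<le> 2 * (B + K * C) / \<delta>" using \<delta> by (simp add: field_simps)
    have "\<bar>x v\<bar> \<le> m + r" if "v \<in> V" for v
    proof -
      have "a v \<le> m" "n v \<le> r" using that by (auto intro!: m_ge r_ge simp: ms_def)
      then show ?thesis using m0 r0 by (auto simp: a_def n_def)
    qed
    moreover have "\<bar>y f\<bar> \<le> m + r" if "f \<in> F" for f
      using m_ge[of "b f"] that r0 by (auto simp: ms_def b_def)
    ultimately show "(\<forall>v\<in>V. \<bar>x v\<bar> \<le> 2 * (B + K * C) / \<delta>) \<and> (\<forall>f\<in>F. \<bar>y f\<bar> \<le> 2 * (B + K * C) / \<delta>)"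
      using R order_trans by blast
  qed
qed

section \<open>Existence of a minimiser and its critical point equations\<close>

text \<open>Tychonoff's theorem, which permits minimising over total functions on a possibly
  infinite type.\<close>

lemma compact_box_functions:
  fixes l r :: "'i \<Rightarrow> real"
  shows "compact (PiE UNIV (\<lambda>i. {l i..r i}))"
proof -
  have "compactin (product_topology (\<lambda>i::'i. euclidean :: real topology) UNIV) (PiE UNIV (\<lambda>i. {l i..r i}))"
    by (simp add: compactin_PiE)
  then show ?thesis by (simp add: euclidean_product_topology)
qed

lemma packing_exists:
  fixes V :: "'a set" and F :: "'b set" and nb :: "'b \<Rightarrow> 'a set" and L :: "'a \<Rightarrow> real" and \<alpha> :: "'b \<Rightarrow> real"
  assumes fin: "finite V" "finite F" and nb: "\<forall>f\<in>F. nb f \<subseteq> V"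
    and Lpos: "\<forall>v\<in>V. 0 < L v"
    and \<alpha>: "\<forall>f\<in>F. 0 < \<alpha> f" "\<forall>f\<in>F. \<alpha> f < pi * card (nb f)"
    and adm: "\<forall>W. W \<subseteq> V \<longrightarrow> W \<noteq> {} \<longrightarrow> (\<Sum>w\<in>W. L w) <
      (\<Sum>f | f \<in> F \<and> W \<inter> nb f \<noteq> {}. min (pi * card (W \<inter> nb f)) (pi * card (nb f) - \<alpha> f))"
  obtains x y where "\<And>f. f \<in> F \<Longrightarrow> 0 < y f"
    "\<And>v. v \<in> V \<Longrightarrow> (\<Sum>f | f \<in> F \<and> v \<in> nb f. arc_curvature (x v) (y f)) = L v"
    "\<And>f. f \<in> F \<Longrightarrow> (\<Sum>v\<in>nb f. sector_angle (x v) (y f)) = \<alpha> f"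
proof -
  obtain \<Phi> where u: "\<And>u s. ((\<lambda>u. \<Phi> u s) has_real_derivative arc_curvature u s) (at u)"
    and s: "\<And>u s. ((\<lambda>s. \<Phi> u s) has_real_derivative sector_angle u s) (at s)"
    by (rule packing_potential) blast
  define E where "E = (\<lambda>x y. (\<Sum>f\<in>F. \<Sum>v\<in>nb f. \<Phi> (x v) (y f)) - (\<Sum>v\<in>V. L v * x v) - (\<Sum>f\<in>F. \<alpha> f * y f))"
  obtain R where R0: "\<forall>x y. (\<Sum>f\<in>F. \<Sum>v\<in>nb f. \<Phi> (x v) (y f)) - (\<Sum>v\<in>V. L v * x v) - (\<Sum>f\<in>F. \<alpha> f * y f) \<le> E (\<lambda>_. 0) (\<lambda>_. 0) \<longrightarrow>
      (\<forall>v\<in>V. \<bar>x v\<bar> \<le> R) \<and> (\<forall>f\<in>F. \<bar>y f\<bar> \<le> R)"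
    using that by (rule energy_coercive[OF u s fin nb Lpos \<alpha> adm])
  have R: "(\<forall>v\<in>V. \<bar>x v\<bar> \<le> R) \<and> (\<forall>f\<in>F. \<bar>y f\<bar> \<le> R)" if "E x y \<le> E (\<lambda>_. 0) (\<lambda>_. 0)" for x y
    by (rule R0[rule_format]) (use that in \<open>simp add: E_def\<close>)
  note nb = nb[rule_format] and \<alpha> = \<alpha>[rule_format]
  \<comment> \<open>Coordinates outside \<open>V\<close> and \<open>F\<close> do not enter the
    energy; degenerate intervals pin them to 0.\<close>
  define bV bF where "bV = (\<lambda>v. if v \<in> V then R else 0)" and "bF = (\<lambda>f. if f \<in> F then R else 0)"
  define box where "box = PiE UNIV (\<lambda>v. {- bV v..bV v}) \<times> PiE UNIV (\<lambda>f. {- bF f..bF f})"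
  have box_iff: "(x, y) \<in> box \<longleftrightarrow> (\<forall>v. \<bar>x v\<bar> \<le> bV v) \<and> (\<forall>f. \<bar>y f\<bar> \<le> bF f)" for x y
    by (auto simp: box_def PiE_iff abs_le_iff minus_le_iff)
  have in_box: "(x, y) \<in> box"
    if "E x y \<le> E (\<lambda>_. 0) (\<lambda>_. 0)" "\<And>v. v \<notin> V \<Longrightarrow> x v = 0" "\<And>f. f \<notin> F \<Longrightarrow> y f = 0" for x y
    using R[OF that(1)] that(2,3) by (auto simp: box_iff bV_def bF_def)
  have "compact box" unfolding box_def by (intro compact_Times compact_box_functions)
  moreover have "(\<lambda>_. 0, \<lambda>_. 0) \<in> box" by (rule in_box) auto
  moreover have "continuous_on box (\<lambda>(x, y). E x y)"
  proof -
    have "continuous_on UNIV (\<lambda>p. \<Phi> (fst p) (snd p))"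
      using has_derivative_from_partials[OF u s continuous_sector_angle]
      by (intro continuous_at_imp_continuous_on) (auto intro: has_derivative_continuous)
    note \<Phi> = this
    have "continuous_on A (\<lambda>z. \<Phi> (g z) (h z))" if "continuous_on A g" "continuous_on A h"
      for A :: "(('a \<Rightarrow> real) \<times> ('b \<Rightarrow> real)) set" and g h
      by (rule continuous_on_compose2[OF \<Phi> continuous_on_Pair[OF that], unfolded fst_conv snd_conv]) simp
    moreover have "continuous_on box (\<lambda>z. fst z v)" for v
      by (rule continuous_on_product_then_coordinatewise[OF continuous_on_fst[OF continuous_on_id]])
    moreover have "continuous_on box (\<lambda>z. snd z f)" for f
      by (rule continuous_on_product_then_coordinatewise[OF continuous_on_snd[OF continuous_on_id]])
    ultimately show ?thesis
      unfolding E_def split_beta by (intro continuous_intros) auto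
  qed
  ultimately obtain z where z: "z \<in> box" and "\<forall>z'\<in>box. (\<lambda>(x, y). E x y) z \<le> (\<lambda>(x, y). E x y) z'"
    using continuous_attains_inf[of box "\<lambda>(x, y). E x y"] by blast
  moreover obtain x y where xy: "z = (x, y)" by (cases z)
  ultimately have box_min: "E x y \<le> E x' y'" if "(x', y') \<in> box" for x' y' using that by force
  have off: "x v = 0" if "v \<notin> V" for v using z that by (auto simp: xy box_iff bV_def dest: spec[of _ v])
  have off': "y f = 0" if "f \<notin> F" for f using z that by (auto simp: xy box_iff bF_def dest: spec[of _ f])
  \<comment> \<open>Outside the box the energy exceeds its value at the origin, which lies in the
    box, so the minimum over the box is global.\<close>
  have glob: "E x y \<le> E x' y'" if "\<And>v. v \<notin> V \<Longrightarrow> x' v = 0" "\<And>f. f \<notin> F \<Longrightarrow> y' f = 0" for x' y'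
    using box_min in_box[OF _ that] box_min[OF \<open>(\<lambda>_. 0, \<lambda>_. 0) \<in> box\<close>] by force
  have finnb: "finite (nb f)" if "f \<in> F" for f using nb[OF that] fin finite_subset by blast
  have curv: "(\<Sum>f | f \<in> F \<and> v \<in> nb f. arc_curvature (x v) (y f)) = L v" if v: "v \<in> V" for v
  proof -
    have "((\<lambda>t. E (x(v := t)) y) has_real_derivative
        (\<Sum>f\<in>F. \<Sum>w\<in>nb f. if w = v then arc_curvature (x v) (y f) else 0)
        - (\<Sum>w\<in>V. if w = v then L v else 0) - 0) (at (x v))"
      unfolding E_def
    proof (intro DERIV_diff DERIV_sum DERIV_const)
      fix f w
      show "((\<lambda>t. \<Phi> ((x(v := t)) w) (y f)) has_real_derivative (if w = v then arc_curvature (x v) (y f) else 0)) (at (x v))"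
        using u by (cases "w = v") auto
      show "((\<lambda>t. L w * (x(v := t)) w) has_real_derivative (if w = v then L v else 0)) (at (x v))"
        by (cases "w = v") (auto intro!: derivative_eq_intros)
    qed
    then have "(\<Sum>f\<in>F. \<Sum>w\<in>nb f. if w = v then arc_curvature (x v) (y f) else 0)
        - (\<Sum>w\<in>V. if w = v then L v else 0) - 0 = 0"
    \<comment> \<open>The minimum is global among functions vanishing off \<open>V\<close> and
      \<open>F\<close>, so any radius would serve; an update at a point of \<open>V\<close> stays in
      this class.\<close>
    proof (rule DERIV_local_min[where d = 1])
      show "\<forall>t. \<bar>x v - t\<bar> < 1 \<longrightarrow> E (x(v := x v)) y \<le> E (x(v := t)) y"
        using v off off' by (auto intro!: glob)
    qed simp
    moreover have "(\<Sum>f\<in>F. \<Sum>w\<in>nb f. if w = v then arc_curvature (x v) (y f) else 0) =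
        (\<Sum>f\<in>F. if v \<in> nb f then arc_curvature (x v) (y f) else 0)"
      using finnb by (intro sum.cong) (auto simp: sum.delta)
    moreover have "\<dots> = (\<Sum>f | f \<in> F \<and> v \<in> nb f. arc_curvature (x v) (y f))"
      using fin by (simp add: sum.If_cases Collect_conj_eq)
    ultimately show ?thesis using fin v by (simp add: sum.delta)
  qed
  have angle: "(\<Sum>v\<in>nb f. sector_angle (x v) (y f)) = \<alpha> f" if f: "f \<in> F" for f
  proof -
    have "((\<lambda>t. E x (y(f := t))) has_real_derivative
        (\<Sum>g\<in>F. \<Sum>w\<in>nb g. if g = f then sector_angle (x w) (y f) else 0)
        - 0 - (\<Sum>g\<in>F. if g = f then \<alpha> f else 0)) (at (y f))"
      unfolding E_def
    proof (intro DERIV_diff DERIV_sum DERIV_const)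
      fix g w
      show "((\<lambda>t. \<Phi> (x w) ((y(f := t)) g)) has_real_derivative (if g = f then sector_angle (x w) (y f) else 0)) (at (y f))"
        using s by (cases "g = f") auto
      show "((\<lambda>t. \<alpha> g * (y(f := t)) g) has_real_derivative (if g = f then \<alpha> f else 0)) (at (y f))"
        by (cases "g = f") (auto intro!: derivative_eq_intros)
    qed
    then have "(\<Sum>g\<in>F. \<Sum>w\<in>nb g. if g = f then sector_angle (x w) (y f) else 0)
        - 0 - (\<Sum>g\<in>F. if g = f then \<alpha> f else 0) = 0"
    proof (rule DERIV_local_min[where d = 1])
      show "\<forall>t. \<bar>y f - t\<bar> < 1 \<longrightarrow> E x (y(f := y f)) \<le> E x (y(f := t))"
        using f off off' by (auto intro!: glob)
    qed simp
    moreover have "(\<Sum>g\<in>F. \<Sum>w\<in>nb g. if g = f then sector_angle (x w) (y f) else 0) =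
        (\<Sum>g\<in>F. if g = f then \<Sum>w\<in>nb f. sector_angle (x w) (y f) else 0)"
      by (intro sum.cong) auto
    ultimately show ?thesis using fin f by (simp add: sum.delta)
  qed
  have "0 < y f" if f: "f \<in> F" for f
  proof (rule ccontr)
    assume "\<not> 0 < y f"
    then have "sector_angle (x v) (y f) \<le> 0" for v
      by (simp add: sector_angle_def divide_nonpos_pos)
    then have "(\<Sum>v\<in>nb f. sector_angle (x v) (y f)) \<le> 0" by (intro sum_nonpos) auto
    then show False using angle[OF f] \<alpha>(1)[OF f] by simp
  qed
  then show ?thesis using curv angle that by blast
qed

section \<open>Uniqueness and necessity\<close>

lemma incidence_sum_swap:
  fixes g :: "'a \<Rightarrow> 'b \<Rightarrow> real"
  assumes "finite W" "finite F"
  shows "(\<Sum>v\<in>W. \<Sum>f | f \<in> F \<and> v \<in> nb f. g v f) = (\<Sum>f\<in>F. \<Sum>v\<in>W \<inter> nb f. g v f)"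
  using sum.swap_restrict[OF assms, of g "\<lambda>v f. v \<in> nb f"] by (simp add: Int_def)

text \<open>Differences of the gradient are paired with differences of the coordinates and summed
  over all incidences. Grouped by vertices the curvature part cancels, grouped by faces the angle
  part cancels. The incidence terms are nonnegative with sum 0, so by strict monotonicity the
  coordinates agree at every incidence, and each vertex and each face occurs in one.\<close>

lemma packing_unique:
  fixes V :: "'a set" and F :: "'b set" and nb :: "'b \<Rightarrow> 'a set"
  assumes fin: "finite V" "finite F" and nb: "\<forall>f\<in>F. nb f \<subseteq> V" "\<forall>f\<in>F. nb f \<noteq> {}" "\<forall>v\<in>V. \<exists>f\<in>F. v \<in> nb f"
    and curv: "\<And>v. v \<in> V \<Longrightarrow> (\<Sum>f | f \<in> F \<and> v \<in> nb f. arc_curvature (x v) (y f)) =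
      (\<Sum>f | f \<in> F \<and> v \<in> nb f. arc_curvature (x' v) (y' f))"
    and angle: "\<And>f. f \<in> F \<Longrightarrow> (\<Sum>v\<in>nb f. sector_angle (x v) (y f)) = (\<Sum>v\<in>nb f. sector_angle (x' v) (y' f))"
  shows "(\<forall>v\<in>V. x v = x' v) \<and> (\<forall>f\<in>F. y f = y' f)"
proof -
  define c where "c = (\<lambda>v f. (arc_curvature (x' v) (y' f) - arc_curvature (x v) (y f)) * (x' v - x v))"
  define d where "d = (\<lambda>v f. (sector_angle (x' v) (y' f) - sector_angle (x v) (y f)) * (y' f - y f))"
  have pos: "0 < c v f + d v f" if "x v \<noteq> x' v \<or> y f \<noteq> y' f" for v f
    unfolding c_def d_def by (rule curvature_angle_strict_mono[OF that])
  then have nonneg: "0 \<le> c v f + d v f" for v f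
    by (cases "x v \<noteq> x' v \<or> y f \<noteq> y' f") (auto simp: c_def d_def less_imp_le)
  have finnb: "finite (nb f)" if "f \<in> F" for f using nb(1) that fin finite_subset by blast
  have "(\<Sum>f\<in>F. \<Sum>v\<in>nb f. c v f) = (\<Sum>v\<in>V. \<Sum>f | f \<in> F \<and> v \<in> nb f. c v f)"
    unfolding incidence_sum_swap[OF fin] using nb(1) by (intro sum.cong) (auto simp: Int_absorb1)
  also have "\<dots> = 0"
    using curv by (intro sum.neutral) (simp add: c_def sum_subtractf flip: sum_distrib_right)
  finally have "(\<Sum>f\<in>F. \<Sum>v\<in>nb f. c v f) = 0" .
  moreover have "(\<Sum>f\<in>F. \<Sum>v\<in>nb f. d v f) = 0"
    using angle by (intro sum.neutral) (simp add: d_def sum_subtractf flip: sum_distrib_right)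
  ultimately have "(\<Sum>f\<in>F. \<Sum>v\<in>nb f. c v f + d v f) = 0" by (simp add: sum.distrib)
  then have "\<forall>f\<in>F. (\<Sum>v\<in>nb f. c v f + d v f) = 0"
    by (subst (asm) sum_nonneg_eq_0_iff[OF fin(2)]) (auto intro: sum_nonneg nonneg)
  then have "c v f + d v f = 0" if "f \<in> F" "v \<in> nb f" for f v
    using sum_nonneg_eq_0_iff[OF finnb[OF that(1)], of "\<lambda>v. c v f + d v f"] nonneg that by simp
  then have "\<forall>f\<in>F. \<forall>v\<in>nb f. x v = x' v \<and> y f = y' f" using pos by (metis less_irrefl)
  then show ?thesis using nb by blast
qed

text \<open>On each face meeting \<open>W\<close>, Gauss-Bonnet bounds the curvature by the sum of
  \<open>pi - sector_angle\<close> over \<open>W \<inter> nb f\<close>. Discarding the positive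
  angles gives one entry of the minimum; adding the positive terms of the remaining vertices gives
  the other.\<close>

lemma packing_curvature_bound:
  fixes V :: "'a set" and F :: "'b set" and nb :: "'b \<Rightarrow> 'a set"
  assumes fin: "finite V" "finite F" and nb: "\<forall>f\<in>F. nb f \<subseteq> V" "\<forall>v\<in>V. \<exists>f\<in>F. v \<in> nb f"
    and y: "\<forall>f\<in>F. 0 < y f" and W: "W \<subseteq> V" "W \<noteq> {}"
  shows "(\<Sum>v\<in>W. \<Sum>f | f \<in> F \<and> v \<in> nb f. arc_curvature (x v) (y f)) <
    (\<Sum>f | f \<in> F \<and> W \<inter> nb f \<noteq> {}. min (pi * card (W \<inter> nb f)) (pi * card (nb f) - (\<Sum>v\<in>nb f. sector_angle (x v) (y f))))"
proof -
  have finW: "finite W" using W(1) fin(1) finite_subset by blast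
  have "(\<Sum>v\<in>W. \<Sum>f | f \<in> F \<and> v \<in> nb f. arc_curvature (x v) (y f)) =
      (\<Sum>f\<in>F. \<Sum>v\<in>W \<inter> nb f. arc_curvature (x v) (y f))"
    by (rule incidence_sum_swap[OF finW fin(2)])
  also have "\<dots> = (\<Sum>f | f \<in> F \<and> W \<inter> nb f \<noteq> {}. \<Sum>v\<in>W \<inter> nb f. arc_curvature (x v) (y f))"
    using fin by (intro sum.mono_neutral_right) auto
  also have "\<dots> < (\<Sum>f | f \<in> F \<and> W \<inter> nb f \<noteq> {}. min (pi * card (W \<inter> nb f))
      (pi * card (nb f) - (\<Sum>v\<in>nb f. sector_angle (x v) (y f))))"
  proof (rule sum_strict_mono)
    show "finite {f \<in> F. W \<inter> nb f \<noteq> {}}" using fin by simp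
    show "{f \<in> F. W \<inter> nb f \<noteq> {}} \<noteq> {}" using W nb(2) by blast
    fix f assume "f \<in> {f \<in> F. W \<inter> nb f \<noteq> {}}"
    then have f: "f \<in> F" "W \<inter> nb f \<noteq> {}" by auto
    have finnb: "finite (nb f)" using nb(1) f fin finite_subset by blast
    have yf: "0 < y f" using y f by blast
    have A: "(\<Sum>v\<in>W \<inter> nb f. arc_curvature (x v) (y f)) < (\<Sum>v\<in>W \<inter> nb f. pi - sector_angle (x v) (y f))"
      using f finW by (intro sum_strict_mono arc_curvature_less yf) auto
    also have "\<dots> \<le> (\<Sum>v\<in>W \<inter> nb f. pi)"
      using sector_angle_bounds(1)[OF yf] by (intro sum_mono) (simp add: less_imp_le)
    finally have 1: "(\<Sum>v\<in>W \<inter> nb f. arc_curvature (x v) (y f)) < pi * card (W \<inter> nb f)" by (simp add: mult.commute)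
    note A
    also have "(\<Sum>v\<in>W \<inter> nb f. pi - sector_angle (x v) (y f)) \<le> (\<Sum>v\<in>nb f. pi - sector_angle (x v) (y f))"
      using sector_angle_bounds(2)[OF yf] finnb by (intro sum_mono2) (auto simp: less_imp_le)
    finally have 2: "(\<Sum>v\<in>W \<inter> nb f. arc_curvature (x v) (y f)) < pi * card (nb f) - (\<Sum>v\<in>nb f. sector_angle (x v) (y f))"
      by (simp add: sum_subtractf mult.commute)
    from 1 2 show "(\<Sum>v\<in>W \<inter> nb f. arc_curvature (x v) (y f)) <
        min (pi * card (W \<inter> nb f)) (pi * card (nb f) - (\<Sum>v\<in>nb f. sector_angle (x v) (y f)))" by simp
  qed
  finally show ?thesis .
qed

section \<open>Packing metrics on a surface\<close>

text \<open>The corner 1 of the closed disc is a limit of interior points, and continuity carries it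
  into the closure of the face. This keeps the angle sum of a face from being empty.\<close>

lemma face_vertices_nonempty:
  assumes "face_cell S V E f"
  shows "face_vertices S V f \<noteq> {}"
proof -
  obtain n \<phi> where n: "1 \<le> n" and cont: "continuous_map (top_of_set (cball (0::complex) 1)) S \<phi>"
    and hom: "homeomorphic_map (top_of_set (ball 0 1)) (subtopology S f) \<phi>"
    and V: "\<forall>j<n. \<phi> (cis (2 * pi * real j / real n)) \<in> V"
    using assms unfolding face_cell_def by blast
  have "\<phi> 1 \<in> V" using V[rule_format, of 0] n by simp
  have "\<phi> ` ball 0 1 \<subseteq> f"
    using homeomorphic_imp_surjective_map[OF hom] by auto
  then have "S closure_of (\<phi> ` ball 0 1) \<subseteq> S closure_of f" by (rule closure_of_mono)
  moreover have "\<phi> ` (top_of_set (cball 0 1) closure_of ball 0 1) \<subseteq> S closure_of (\<phi> ` ball 0 1)"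
    by (rule continuous_map_image_closure_subset[OF cont])
  moreover have "1 \<in> top_of_set (cball (0::complex) 1) closure_of ball 0 1"
    by (simp add: closure_of_subtopology Int_absorb1 ball_subset_cball)
  ultimately have "\<phi> 1 \<in> S closure_of f" by blast
  with \<open>\<phi> 1 \<in> V\<close> show ?thesis by (auto simp: face_vertices_def)
qed

lemma vertex_in_some_face:
  assumes "polygonal_decomposition S V E F" "v \<in> V"
  shows "\<exists>f\<in>F. v \<in> face_vertices S V f"
proof -
  have "v \<in> topspace S" "topspace S = (\<Union>f\<in>F. S closure_of f)"
    using assms unfolding polygonal_decomposition_def by auto
  then show ?thesis using assms(2) by (auto simp: face_vertices_def)
qed

lemma total_geodesic_curvature_eq:
  assumes "gcp_metric V F k kf" "v \<in> V"
  shows "total_geodesic_curvature S V F k kf v =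
    (\<Sum>f | f \<in> F \<and> v \<in> face_vertices S V f. arc_curvature (ln (k v)) (arcosh (kf f)))"
  unfolding total_geodesic_curvature_def using assms
  by (intro sum.cong) (auto simp: gcp_metric_def arc_curvature_eq_arc_length)

lemma cone_angle_eq:
  assumes "gcp_metric V F k kf" "f \<in> F"
  shows "cone_angle S V k kf f =
    (\<Sum>v\<in>face_vertices S V f. sector_angle (ln (k v)) (arcosh (kf f)))"
  unfolding cone_angle_def using assms
  by (intro sum.cong) (auto simp: gcp_metric_def face_vertices_def sector_angle_eq_central_angle)

theorem theorem1p5:
  fixes S :: "'a topology" and V :: "'a set" and E F :: "'a set set"
    and L :: "'a \<Rightarrow> real" and Y :: "'a set \<Rightarrow> real"
  assumes "surface S" and "polygonal_decomposition S V E F"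
  shows "((\<exists>k kf. gcp_metric V F k kf \<and>
             (\<forall>v\<in>V. total_geodesic_curvature S V F k kf v = L v) \<and>
             (\<forall>f\<in>F. discrete_curvature S V k kf f = Y f)) \<longleftrightarrow>
          (\<forall>f\<in>F. Y f \<in> {(2 - real (card (face_vertices S V f))) * pi<..<2 * pi}) \<and>
          L \<in> admissible_curvatures S V F Y) \<and>
         (\<forall>k kf k' kf'.
            gcp_metric V F k kf \<and>
            (\<forall>v\<in>V. total_geodesic_curvature S V F k kf v = L v) \<and>
            (\<forall>f\<in>F. discrete_curvature S V k kf f = Y f) \<and>
            gcp_metric V F k' kf' \<and>
            (\<forall>v\<in>V. total_geodesic_curvature S V F k' kf' v = L v) \<and>
            (\<forall>f\<in>F. discrete_curvature S V k' kf' f = Y f) \<longrightarrow>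
            (\<forall>v\<in>V. k v = k' v) \<and> (\<forall>f\<in>F. kf f = kf' f))"
proof (intro conjI iffI allI impI)
  define nb where "nb = face_vertices S V"
  define \<alpha> where "\<alpha> = (\<lambda>f. 2 * pi - Y f)"
  have fin: "finite V" "finite F" using assms(2) by (auto simp: polygonal_decomposition_def)
  have nb: "\<forall>f\<in>F. nb f \<subseteq> V" "\<forall>f\<in>F. nb f \<noteq> {}" "\<forall>v\<in>V. \<exists>f\<in>F. v \<in> nb f"
  proof -
    show "\<forall>f\<in>F. nb f \<subseteq> V" by (auto simp: nb_def face_vertices_def)
    show "\<forall>f\<in>F. nb f \<noteq> {}"
      unfolding nb_def
      by (intro ballI face_vertices_nonempty[where E = E]) (use assms(2) in \<open>simp add: polygonal_decomposition_def\<close>)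
    show "\<forall>v\<in>V. \<exists>f\<in>F. v \<in> nb f"
      unfolding nb_def using vertex_in_some_face[OF assms(2)] by blast
  qed
  have finnb: "finite (nb f)" if "f \<in> F" for f using nb(1) that fin finite_subset by blast
  \<comment> \<open>Passing to cone angles: \<open>pi\<close> times
    \<open>real (card (nb f)) - 2 + Y f / pi\<close> is
    \<open>pi * card (nb f) - \<alpha> f\<close>.\<close>
  have adm_iff: "L \<in> admissible_curvatures S V F Y \<longleftrightarrow> (\<forall>v\<in>V. 0 < L v) \<and>
      (\<forall>W. W \<subseteq> V \<longrightarrow> W \<noteq> {} \<longrightarrow> (\<Sum>w\<in>W. L w) <
        (\<Sum>f | f \<in> F \<and> W \<inter> nb f \<noteq> {}. min (pi * card (W \<inter> nb f)) (pi * card (nb f) - \<alpha> f)))"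
  proof -
    have "pi * min (real (card (W \<inter> nb f))) (real (card (nb f)) - 2 + Y f / pi) =
        min (pi * card (W \<inter> nb f)) (pi * card (nb f) - \<alpha> f)" for W f
      by (simp add: min_mult_distrib_left \<alpha>_def algebra_simps)
    moreover have "faces_meeting S V F W = {f \<in> F. W \<inter> nb f \<noteq> {}}" for W
      by (auto simp: faces_meeting_def nb_def)
    ultimately show ?thesis
      unfolding admissible_curvatures_def nb_def[symmetric] by (simp add: imp_conjL)
  qed
  have Y_iff: "Y f \<in> {(2 - real (card (face_vertices S V f))) * pi<..<2 * pi} \<longleftrightarrow>
      0 < \<alpha> f \<and> \<alpha> f < pi * card (nb f)" for f
    by (auto simp: \<alpha>_def nb_def algebra_simps)
  \<comment> \<open>Translation of a realising metric into logarithmic coordinates, shared by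
    necessity and uniqueness.\<close>
  have realized: "\<forall>f\<in>F. 0 < arcosh (kf f)"
    "\<And>v. v \<in> V \<Longrightarrow> (\<Sum>f | f \<in> F \<and> v \<in> nb f. arc_curvature (ln (k v)) (arcosh (kf f))) = L v"
    "\<And>f. f \<in> F \<Longrightarrow> (\<Sum>v\<in>nb f. sector_angle (ln (k v)) (arcosh (kf f))) = \<alpha> f"
    if "gcp_metric V F k kf \<and> (\<forall>v\<in>V. total_geodesic_curvature S V F k kf v = L v) \<and>
      (\<forall>f\<in>F. discrete_curvature S V k kf f = Y f)" for k kf
    using that total_geodesic_curvature_eq[of V F k kf _ S] cone_angle_eq[of V F k kf _ S]
    by (auto simp: nb_def \<alpha>_def discrete_curvature_def gcp_metric_def)
  {
    assume "\<exists>k kf. gcp_metric V F k kf \<and> (\<forall>v\<in>V. total_geodesic_curvature S V F k kf v = L v) \<and>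
      (\<forall>f\<in>F. discrete_curvature S V k kf f = Y f)"
    then obtain k kf where K: "gcp_metric V F k kf \<and> (\<forall>v\<in>V. total_geodesic_curvature S V F k kf v = L v) \<and>
      (\<forall>f\<in>F. discrete_curvature S V k kf f = Y f)" by blast
    define x y where "x = (\<lambda>v. ln (k v))" and "y = (\<lambda>f. arcosh (kf f))"
    note r = realized[OF K, folded x_def y_def]
    have y: "\<forall>f\<in>F. 0 < y f" using r(1) by (simp add: y_def)
    have L: "L v = (\<Sum>f | f \<in> F \<and> v \<in> nb f. arc_curvature (x v) (y f))" if "v \<in> V" for v
      using r(2)[OF that] by (simp add: x_def y_def)
    have \<alpha>: "\<alpha> f = (\<Sum>v\<in>nb f. sector_angle (x v) (y f))" if "f \<in> F" for f
      using r(3)[OF that] by (simp add: x_def y_def)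
    show "\<forall>f\<in>F. Y f \<in> {(2 - real (card (face_vertices S V f))) * pi<..<2 * pi}"
    proof
      fix f assume f: "f \<in> F"
      have "0 < \<alpha> f"
        unfolding \<alpha>[OF f] using finnb nb(2) f y by (intro sum_pos sector_angle_bounds(1)) auto
      moreover have "\<alpha> f < (\<Sum>v\<in>nb f. pi)"
        unfolding \<alpha>[OF f] using finnb nb(2) f y by (intro sum_strict_mono sector_angle_bounds(2)) auto
      ultimately show "Y f \<in> {(2 - real (card (face_vertices S V f))) * pi<..<2 * pi}"
        unfolding Y_iff by (simp add: mult.commute)
    qed
    have "0 < L v" if "v \<in> V" for v
      unfolding L[OF that] using fin nb(3) that by (intro sum_pos arc_curvature_pos) auto
    moreover have "(\<Sum>w\<in>W. L w) <
        (\<Sum>f | f \<in> F \<and> W \<inter> nb f \<noteq> {}. min (pi * card (W \<inter> nb f)) (pi * card (nb f) - \<alpha> f))"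
      if "W \<subseteq> V" "W \<noteq> {}" for W
    proof -
      have "(\<Sum>w\<in>W. L w) = (\<Sum>v\<in>W. \<Sum>f | f \<in> F \<and> v \<in> nb f. arc_curvature (x v) (y f))"
        using that L by (intro sum.cong) auto
      also have "\<dots> < (\<Sum>f | f \<in> F \<and> W \<inter> nb f \<noteq> {}. min (pi * card (W \<inter> nb f))
          (pi * card (nb f) - (\<Sum>v\<in>nb f. sector_angle (x v) (y f))))"
        by (rule packing_curvature_bound[OF fin nb(1,3) y that])
      also have "\<dots> = (\<Sum>f | f \<in> F \<and> W \<inter> nb f \<noteq> {}. min (pi * card (W \<inter> nb f)) (pi * card (nb f) - \<alpha> f))"
        by (intro sum.cong) (auto simp: \<alpha>)
      finally show ?thesis .
    qed
    ultimately show "L \<in> admissible_curvatures S V F Y" unfolding adm_iff by blast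
  }
  {
    assume "(\<forall>f\<in>F. Y f \<in> {(2 - real (card (face_vertices S V f))) * pi<..<2 * pi}) \<and>
      L \<in> admissible_curvatures S V F Y"
    then have A: "\<forall>f\<in>F. 0 < \<alpha> f" "\<forall>f\<in>F. \<alpha> f < pi * card (nb f)" "\<forall>v\<in>V. 0 < L v"
      and W: "\<forall>W. W \<subseteq> V \<longrightarrow> W \<noteq> {} \<longrightarrow> (\<Sum>w\<in>W. L w) <
        (\<Sum>f | f \<in> F \<and> W \<inter> nb f \<noteq> {}. min (pi * card (W \<inter> nb f)) (pi * card (nb f) - \<alpha> f))"
      unfolding adm_iff Y_iff by blast+
    obtain x y where y: "\<And>f. f \<in> F \<Longrightarrow> 0 < y f"
      and L: "\<And>v. v \<in> V \<Longrightarrow> (\<Sum>f | f \<in> F \<and> v \<in> nb f. arc_curvature (x v) (y f)) = L v"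
      and \<alpha>: "\<And>f. f \<in> F \<Longrightarrow> (\<Sum>v\<in>nb f. sector_angle (x v) (y f)) = \<alpha> f"
      by (rule packing_exists[OF fin nb(1) A(3,1,2) W]) blast
    \<comment> \<open>Back to curvatures: \<open>0 < y f\<close> ensures both
      \<open>1 < kf f\<close> and that \<open>arcosh\<close> recovers \<open>y f\<close>.\<close>
    define k kf where "k = (\<lambda>v. exp (x v))" and "kf = (\<lambda>f. cosh (y f))"
    have g: "gcp_metric V F k kf"
      using y cosh_real_ge_1 by (force simp: gcp_metric_def k_def kf_def less_le)
    have yk: "arcosh (kf f) = y f" if "f \<in> F" for f
      using y[OF that] by (simp add: kf_def arcosh_cosh_real)
    have "total_geodesic_curvature S V F k kf v = L v" if "v \<in> V" for v
      unfolding total_geodesic_curvature_eq[OF g that] L[OF that, symmetric] nb_def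
      by (intro sum.cong) (auto simp: k_def yk)
    moreover have "discrete_curvature S V k kf f = Y f" if "f \<in> F" for f
    proof -
      have "cone_angle S V k kf f = \<alpha> f"
        unfolding cone_angle_eq[OF g that] \<alpha>[OF that, symmetric] nb_def
        using that by (simp add: k_def yk)
      then show ?thesis by (simp add: discrete_curvature_def \<alpha>_def)
    qed
    ultimately show "\<exists>k kf. gcp_metric V F k kf \<and> (\<forall>v\<in>V. total_geodesic_curvature S V F k kf v = L v) \<and>
      (\<forall>f\<in>F. discrete_curvature S V k kf f = Y f)" using g by blast
  }
  fix k kf k' kf'
  assume K: "gcp_metric V F k kf \<and>
    (\<forall>v\<in>V. total_geodesic_curvature S V F k kf v = L v) \<and>
    (\<forall>f\<in>F. discrete_curvature S V k kf f = Y f) \<and>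
    gcp_metric V F k' kf' \<and>
    (\<forall>v\<in>V. total_geodesic_curvature S V F k' kf' v = L v) \<and>
    (\<forall>f\<in>F. discrete_curvature S V k' kf' f = Y f)"
  then have r: "gcp_metric V F k kf \<and> (\<forall>v\<in>V. total_geodesic_curvature S V F k kf v = L v) \<and>
      (\<forall>f\<in>F. discrete_curvature S V k kf f = Y f)"
    and r': "gcp_metric V F k' kf' \<and> (\<forall>v\<in>V. total_geodesic_curvature S V F k' kf' v = L v) \<and>
      (\<forall>f\<in>F. discrete_curvature S V k' kf' f = Y f)" by blast+
  have eq: "(\<forall>v\<in>V. ln (k v) = ln (k' v)) \<and> (\<forall>f\<in>F. arcosh (kf f) = arcosh (kf' f))"
    by (rule packing_unique[OF fin nb, where y = "\<lambda>f. arcosh (kf f)" and y' = "\<lambda>f. arcosh (kf' f)"])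
      (simp_all add: realized(2,3)[OF r] realized(2,3)[OF r'])
  show "\<forall>v\<in>V. k v = k' v"
    using eq K by (auto simp: gcp_metric_def)
  show "\<forall>f\<in>F. kf f = kf' f"
  proof
    fix f assume f: "f \<in> F"
    then have "cosh (arcosh (kf f)) = cosh (arcosh (kf' f))" using eq by simp
    moreover have "1 < kf f" "1 < kf' f" using K f by (auto simp: gcp_metric_def)
    ultimately show "kf f = kf' f" by simp
  qed
qed

end
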